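(* The following is provable in $\mathbf{ZF}$ (Zermelo-Fraenkel set theory without the axiom of choice): for all $\mathbb{R}$-trees $S$ and $T$, if there exists a quasi-isometry $S\to T$, then there exists a quasi-isometry $T\to S$.
   Context: Quasi-isometry: for metric spaces $(S,d_S)$ and $(T,d_T)$, a function $f:S\to T$ is a quasi-isometry if there exists a natural number $N\ge 1$ such that $B(f(S),N)=T$ and for all $x,y\in S$, $\frac1N d_S(x,y)-N\le d_T(f(x),f(y))\le N d_S(x,y)+N$. Here, for $J\subseteq T$, $B(J,p)=\{x\in T: d_T(x,J)\le p\}$ is the closed $p$-neighborhood (with $d_T(x,\emptyset)=+\infty$). A metric space $S$ is geodesic if for any $x,y\in S$ there is an isometric embedding $\rho:[0,d_S(x,y)]\to S$ with $\rho(0)=x$, $\rho(d_S(x,y))=y$; its image is called a geodesic segment, denoted $[x,y]$. A geodesic space $S$ is $\delta$-hyperbolic if for any $x,y,z\in S$ (and any choice of geodesic segments) $[x,y]\subseteq B([x,z]\cup[y,z],\delta)$. An $\mathbb{R}$-tree is a $0$-hyperbolic geodesic space (geodesic segments are then unique). *)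

theory Defs
  imports Main
begin

section \<open>First-order logic over the language of set theory\<close>

text \<open>Formulas are in de Bruijn form: the index i refers to the i-th enclosing quantifier,
  counted from the inside. The language has no function symbols, so the only terms are variables
  and every substitution is a renaming.\<close>

datatype fm = Mem nat nat | Eq nat nat | Fls | Imp fm fm | All fm

primrec ren :: "(nat \<Rightarrow> nat) \<Rightarrow> fm \<Rightarrow> fm" where
  "ren r (Mem i j) = Mem (r i) (r j)"
| "ren r (Eq i j) = Eq (r i) (r j)"
| "ren r Fls = Fls"
| "ren r (Imp \<phi> \<psi>) = Imp (ren r \<phi>) (ren r \<psi>)"
| "ren r (All \<phi>) = All (ren (case_nat 0 (\<lambda>i. Suc (r i))) \<phi>)"

primrec free_below :: "nat \<Rightarrow> fm \<Rightarrow> bool" where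
  "free_below n (Mem i j) \<longleftrightarrow> i < n \<and> j < n"
| "free_below n (Eq i j) \<longleftrightarrow> i < n \<and> j < n"
| "free_below n Fls \<longleftrightarrow> True"
| "free_below n (Imp \<phi> \<psi>) \<longleftrightarrow> free_below n \<phi> \<and> free_below n \<psi>"
| "free_below n (All \<phi>) \<longleftrightarrow> free_below (Suc n) \<phi>"

text \<open>The renaming \<open>case_nat x id\<close> replaces the variable 0 by x and lowers all others, as needed
  when a quantifier is removed.\<close>

inductive derives :: "fm set \<Rightarrow> fm \<Rightarrow> bool" (infix "\<turnstile>" 50) where
  hyp: "\<phi> \<in> \<Gamma> \<Longrightarrow> \<Gamma> \<turnstile> \<phi>"
| impI: "insert \<phi> \<Gamma> \<turnstile> \<psi> \<Longrightarrow> \<Gamma> \<turnstile> Imp \<phi> \<psi>"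
| impE: "\<Gamma> \<turnstile> Imp \<phi> \<psi> \<Longrightarrow> \<Gamma> \<turnstile> \<phi> \<Longrightarrow> \<Gamma> \<turnstile> \<psi>"
| raa: "insert (Imp \<phi> Fls) \<Gamma> \<turnstile> Fls \<Longrightarrow> \<Gamma> \<turnstile> \<phi>"
| allI: "ren Suc ` \<Gamma> \<turnstile> \<phi> \<Longrightarrow> \<Gamma> \<turnstile> All \<phi>"
| allE: "\<Gamma> \<turnstile> All \<phi> \<Longrightarrow> \<Gamma> \<turnstile> ren (case_nat x id) \<phi>"
| eq_refl: "\<Gamma> \<turnstile> Eq x x"
| eq_subst: "\<Gamma> \<turnstile> Eq x y \<Longrightarrow> \<Gamma> \<turnstile> ren (case_nat x id) \<phi> \<Longrightarrow> \<Gamma> \<turnstile> ren (case_nat y id) \<phi>"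


section \<open>Readable notation for formulas\<close>

text \<open>A \<open>form\<close> is a formula waiting for the number d of quantifiers that enclose it. Here variables
  are named by levels, counted from the outside, so that a variable keeps its name under further
  quantifiers: level x is the de Bruijn index \<open>d - Suc x\<close>, and a quantifier met at depth d binds
  level d. This lets HOL bound variables stand for object-level ones. A closed formula is obtained
  by starting at depth 0.\<close>

type_synonym form = "nat \<Rightarrow> fm"

definition close :: "form \<Rightarrow> fm" where
  "close P = P 0"

definition fMem :: "nat \<Rightarrow> nat \<Rightarrow> form" (infix "\<^bold>\<in>" 50) where
  "x \<^bold>\<in> y = (\<lambda>d. Mem (d - Suc x) (d - Suc y))"

definition fEq :: "nat \<Rightarrow> nat \<Rightarrow> form" (infix "\<^bold>=" 50) where
  "x \<^bold>= y = (\<lambda>d. Eq (d - Suc x) (d - Suc y))"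

definition fImp :: "form \<Rightarrow> form \<Rightarrow> form" (infixr "\<^bold>\<longrightarrow>" 25) where
  "(P \<^bold>\<longrightarrow> Q) = (\<lambda>d. Imp (P d) (Q d))"

definition fNot :: "form \<Rightarrow> form" ("\<^bold>\<not> _" [40] 40) where
  "(\<^bold>\<not> P) = (P \<^bold>\<longrightarrow> (\<lambda>d. Fls))"

definition fOr :: "form \<Rightarrow> form \<Rightarrow> form" (infixr "\<^bold>\<or>" 30) where
  "(P \<^bold>\<or> Q) = (\<^bold>\<not> P \<^bold>\<longrightarrow> Q)"

definition fAnd :: "form \<Rightarrow> form \<Rightarrow> form" (infixr "\<^bold>\<and>" 35) where
  "(P \<^bold>\<and> Q) = (\<^bold>\<not> (P \<^bold>\<longrightarrow> \<^bold>\<not> Q))"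

definition fIff :: "form \<Rightarrow> form \<Rightarrow> form" (infixr "\<^bold>\<longleftrightarrow>" 25) where
  "(P \<^bold>\<longleftrightarrow> Q) = ((P \<^bold>\<longrightarrow> Q) \<^bold>\<and> (Q \<^bold>\<longrightarrow> P))"

definition fAll :: "(nat \<Rightarrow> form) \<Rightarrow> form" (binder "\<^bold>\<forall>" 10) where
  "fAll P = (\<lambda>d. All (P d (Suc d)))"

definition fEx :: "(nat \<Rightarrow> form) \<Rightarrow> form" (binder "\<^bold>\<exists>" 10) where
  "fEx P = (\<^bold>\<not> (\<^bold>\<forall>x. \<^bold>\<not> P x))"

definition fBall :: "nat \<Rightarrow> (nat \<Rightarrow> form) \<Rightarrow> form" where
  "fBall A P = (\<^bold>\<forall>x. x \<^bold>\<in> A \<^bold>\<longrightarrow> P x)"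

definition fBex :: "nat \<Rightarrow> (nat \<Rightarrow> form) \<Rightarrow> form" where
  "fBex A P = (\<^bold>\<exists>x. x \<^bold>\<in> A \<^bold>\<and> P x)"

syntax
  "_fBall" :: "pttrn \<Rightarrow> nat \<Rightarrow> form \<Rightarrow> form" ("(3\<^bold>\<forall>_\<^bold>\<in>_./ _)" [0, 51, 10] 10)
  "_fBex" :: "pttrn \<Rightarrow> nat \<Rightarrow> form \<Rightarrow> form" ("(3\<^bold>\<exists>_\<^bold>\<in>_./ _)" [0, 51, 10] 10)
translations
  "\<^bold>\<forall>x\<^bold>\<in>A. P" \<rightleftharpoons> "CONST fBall A (\<lambda>x. P)"
  "\<^bold>\<exists>x\<^bold>\<in>A. P" \<rightleftharpoons> "CONST fBex A (\<lambda>x. P)"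

text \<open>\<open>plug \<phi> xs\<close> is \<open>\<phi>\<close> with its free variable i replaced by the i-th element of xs;
  \<open>fAlls n P\<close> quantifies over a list of n variables.\<close>

definition plug :: "fm \<Rightarrow> nat list \<Rightarrow> form" where
  "plug \<phi> xs = (\<lambda>d. ren (\<lambda>i. d - Suc (xs ! i)) \<phi>)"

primrec fAlls :: "nat \<Rightarrow> (nat list \<Rightarrow> form) \<Rightarrow> form" where
  "fAlls 0 P = P []"
| "fAlls (Suc n) P = (\<^bold>\<forall>x. fAlls n (\<lambda>xs. P (x # xs)))"


section \<open>The axioms of ZF\<close>

definition extensionality :: form where
  "extensionality = (\<^bold>\<forall>x y. (\<^bold>\<forall>z. z \<^bold>\<in> x \<^bold>\<longleftrightarrow> z \<^bold>\<in> y) \<^bold>\<longrightarrow> x \<^bold>= y)"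

definition pairing :: form where
  "pairing = (\<^bold>\<forall>x y. \<^bold>\<exists>a. \<^bold>\<forall>z. z \<^bold>\<in> a \<^bold>\<longleftrightarrow> z \<^bold>= x \<^bold>\<or> z \<^bold>= y)"

definition separation :: "nat \<Rightarrow> fm \<Rightarrow> form" where
  "separation n \<phi> = fAlls n (\<lambda>ps. \<^bold>\<forall>a. \<^bold>\<exists>b. \<^bold>\<forall>x. x \<^bold>\<in> b \<^bold>\<longleftrightarrow> x \<^bold>\<in> a \<^bold>\<and> plug \<phi> (x # ps))"

definition union_ax :: form where
  "union_ax = (\<^bold>\<forall>a. \<^bold>\<exists>u. \<^bold>\<forall>x. x \<^bold>\<in> u \<^bold>\<longleftrightarrow> (\<^bold>\<exists>y\<^bold>\<in>a. x \<^bold>\<in> y))"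

definition power_set :: form where
  "power_set = (\<^bold>\<forall>a. \<^bold>\<exists>p. \<^bold>\<forall>x. x \<^bold>\<in> p \<^bold>\<longleftrightarrow> (\<^bold>\<forall>y\<^bold>\<in>x. y \<^bold>\<in> a))"

definition infinity :: form where
  "infinity = (\<^bold>\<exists>a. (\<^bold>\<exists>e\<^bold>\<in>a. \<^bold>\<forall>z. \<^bold>\<not> z \<^bold>\<in> e) \<^bold>\<and>
     (\<^bold>\<forall>x\<^bold>\<in>a. \<^bold>\<exists>y\<^bold>\<in>a. \<^bold>\<forall>z. z \<^bold>\<in> y \<^bold>\<longleftrightarrow> z \<^bold>\<in> x \<^bold>\<or> z \<^bold>= x))"

definition replacement :: "nat \<Rightarrow> fm \<Rightarrow> form" where
  "replacement n \<phi> = fAlls n (\<lambda>ps.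
     (\<^bold>\<forall>x y z. plug \<phi> (x # y # ps) \<^bold>\<and> plug \<phi> (x # z # ps) \<^bold>\<longrightarrow> y \<^bold>= z) \<^bold>\<longrightarrow>
     (\<^bold>\<forall>a. \<^bold>\<exists>b. \<^bold>\<forall>y. y \<^bold>\<in> b \<^bold>\<longleftrightarrow> (\<^bold>\<exists>x\<^bold>\<in>a. plug \<phi> (x # y # ps))))"

definition regularity :: form where
  "regularity = (\<^bold>\<forall>a. (\<^bold>\<exists>x. x \<^bold>\<in> a) \<^bold>\<longrightarrow> (\<^bold>\<exists>x\<^bold>\<in>a. \<^bold>\<not> (\<^bold>\<exists>z\<^bold>\<in>x. z \<^bold>\<in> a)))"

definition ZF :: "fm set" where
  "ZF = close ` ({extensionality, pairing, union_ax, power_set, infinity, regularity}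
     \<union> {separation n \<phi> |n \<phi>. free_below (Suc n) \<phi>}
     \<union> {replacement n \<phi> |n \<phi>. free_below (Suc (Suc n)) \<phi>})"


section \<open>Pairs and functions\<close>

definition is_upair :: "nat \<Rightarrow> nat \<Rightarrow> nat \<Rightarrow> form" where
  "is_upair p x y = (\<^bold>\<forall>z. z \<^bold>\<in> p \<^bold>\<longleftrightarrow> z \<^bold>= x \<^bold>\<or> z \<^bold>= y)"

definition is_pair :: "nat \<Rightarrow> nat \<Rightarrow> nat \<Rightarrow> form" where
  "is_pair p x y = (\<^bold>\<forall>z. z \<^bold>\<in> p \<^bold>\<longleftrightarrow> is_upair z x x \<^bold>\<or> is_upair z x y)"

definition pair_in :: "nat \<Rightarrow> nat \<Rightarrow> nat \<Rightarrow> form" where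
  "pair_in f x y = (\<^bold>\<exists>p\<^bold>\<in>f. is_pair p x y)"

definition triple_in :: "nat \<Rightarrow> nat \<Rightarrow> nat \<Rightarrow> nat \<Rightarrow> form" where
  "triple_in g x y z = (\<^bold>\<exists>p. is_pair p x y \<^bold>\<and> pair_in g p z)"

text \<open>Domains and codomains are given by predicates, so that both sets and real intervals can be
  used; \<open>elem A\<close> is the predicate of a set A.\<close>

definition elem :: "nat \<Rightarrow> nat \<Rightarrow> form" where
  "elem A x = (x \<^bold>\<in> A)"

definition is_function :: "nat \<Rightarrow> (nat \<Rightarrow> form) \<Rightarrow> (nat \<Rightarrow> form) \<Rightarrow> form" where
  "is_function f A B =
     ((\<^bold>\<forall>p\<^bold>\<in>f. \<^bold>\<exists>x y. A x \<^bold>\<and> B y \<^bold>\<and> is_pair p x y) \<^bold>\<and>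
      (\<^bold>\<forall>x. A x \<^bold>\<longrightarrow> (\<^bold>\<exists>y. pair_in f x y)) \<^bold>\<and>
      (\<^bold>\<forall>x y z. pair_in f x y \<^bold>\<and> pair_in f x z \<^bold>\<longrightarrow> y \<^bold>= z))"

definition is_binary_function :: "nat \<Rightarrow> nat \<Rightarrow> nat \<Rightarrow> form" where
  "is_binary_function g A B =
     is_function g (\<lambda>p. \<^bold>\<exists>x\<^bold>\<in>A. \<^bold>\<exists>y\<^bold>\<in>A. is_pair p x y) (elem B)"

text \<open>A term is represented by the map sending a property k to the formula "the value of the term
  exists and satisfies k". All values are unique where terms are used below.\<close>

type_synonym trm = "(nat \<Rightarrow> form) \<Rightarrow> form"

definition V :: "nat \<Rightarrow> trm" where
  "V x = (\<lambda>k. k x)"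

definition app :: "nat \<Rightarrow> trm \<Rightarrow> trm" where
  "app f s = (\<lambda>k. s (\<lambda>x. \<^bold>\<exists>y. pair_in f x y \<^bold>\<and> k y))"

definition app2 :: "nat \<Rightarrow> trm \<Rightarrow> trm \<Rightarrow> trm" where
  "app2 g s t = (\<lambda>k. s (\<lambda>x. t (\<lambda>y. \<^bold>\<exists>z. triple_in g x y z \<^bold>\<and> k z)))"

definition tEq :: "trm \<Rightarrow> trm \<Rightarrow> form" (infix "\<^bold>\<doteq>" 50) where
  "s \<^bold>\<doteq> t = s (\<lambda>x. t (\<lambda>y. x \<^bold>= y))"


section \<open>Real numbers\<close>

text \<open>The reals enter as an arbitrary complete ordered field: six variables for the carrier,
  0, 1, addition, multiplication and the order relation. ZF proves that such a field exists and is
  unique up to isomorphism, so quantifying over all of them covers every construction of the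
  reals and depends on none.\<close>

record ofield =
  carr :: nat
  zer :: nat
  uni :: nat
  addition :: nat
  multiplication :: nat
  order :: nat

definition tAdd :: "trm \<Rightarrow> ofield \<Rightarrow> trm \<Rightarrow> trm" ("_ \<oplus>\<^bsub>_\<^esub> _" [65, 0, 66] 65) where
  "s \<oplus>\<^bsub>F\<^esub> t = app2 (addition F) s t"

definition tMul :: "trm \<Rightarrow> ofield \<Rightarrow> trm \<Rightarrow> trm" ("_ \<otimes>\<^bsub>_\<^esub> _" [70, 0, 71] 70) where
  "s \<otimes>\<^bsub>F\<^esub> t = app2 (multiplication F) s t"

definition tLe :: "trm \<Rightarrow> ofield \<Rightarrow> trm \<Rightarrow> form" ("_ \<preceq>\<^bsub>_\<^esub> _" [51, 0, 51] 50) where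
  "s \<preceq>\<^bsub>F\<^esub> t = s (\<lambda>x. t (\<lambda>y. pair_in (order F) x y))"

definition tZero :: "ofield \<Rightarrow> trm" ("\<zero>\<^bsub>_\<^esub>") where
  "\<zero>\<^bsub>F\<^esub> = V (zer F)"

definition tOne :: "ofield \<Rightarrow> trm" ("\<one>\<^bsub>_\<^esub>") where
  "\<one>\<^bsub>F\<^esub> = V (uni F)"

definition tSub :: "trm \<Rightarrow> ofield \<Rightarrow> trm \<Rightarrow> trm" ("_ \<ominus>\<^bsub>_\<^esub> _" [65, 0, 66] 65) where
  "s \<ominus>\<^bsub>F\<^esub> t = (\<lambda>k. \<^bold>\<exists>z\<^bold>\<in>carr F. (t \<oplus>\<^bsub>F\<^esub> V z \<^bold>\<doteq> s) \<^bold>\<and> k z)"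

definition tDiv :: "trm \<Rightarrow> ofield \<Rightarrow> trm \<Rightarrow> trm" ("_ \<oslash>\<^bsub>_\<^esub> _" [70, 0, 71] 70) where
  "s \<oslash>\<^bsub>F\<^esub> t = (\<lambda>k. \<^bold>\<exists>z\<^bold>\<in>carr F. (t \<otimes>\<^bsub>F\<^esub> V z \<^bold>\<doteq> s) \<^bold>\<and> k z)"

definition tAbs :: "ofield \<Rightarrow> trm \<Rightarrow> trm" where
  "tAbs F s = (\<lambda>k. \<^bold>\<exists>z\<^bold>\<in>carr F.
     ((\<zero>\<^bsub>F\<^esub> \<preceq>\<^bsub>F\<^esub> s) \<^bold>\<longrightarrow> (V z \<^bold>\<doteq> s)) \<^bold>\<and>
     (\<^bold>\<not> (\<zero>\<^bsub>F\<^esub> \<preceq>\<^bsub>F\<^esub> s) \<^bold>\<longrightarrow> (V z \<^bold>\<doteq> \<zero>\<^bsub>F\<^esub> \<ominus>\<^bsub>F\<^esub> s)) \<^bold>\<and> k z)"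

definition is_field :: "ofield \<Rightarrow> form" where
  "is_field F = (let R = carr F in
     is_binary_function (addition F) R R \<^bold>\<and>
     is_binary_function (multiplication F) R R \<^bold>\<and>
     zer F \<^bold>\<in> R \<^bold>\<and> uni F \<^bold>\<in> R \<^bold>\<and> \<^bold>\<not> (zer F \<^bold>= uni F) \<^bold>\<and>
     (\<^bold>\<forall>x\<^bold>\<in>R. \<^bold>\<forall>y\<^bold>\<in>R. \<^bold>\<forall>z\<^bold>\<in>R.
        ((V x \<oplus>\<^bsub>F\<^esub> V y) \<oplus>\<^bsub>F\<^esub> V z \<^bold>\<doteq> V x \<oplus>\<^bsub>F\<^esub> (V y \<oplus>\<^bsub>F\<^esub> V z)) \<^bold>\<and>
        ((V x \<otimes>\<^bsub>F\<^esub> V y) \<otimes>\<^bsub>F\<^esub> V z \<^bold>\<doteq> V x \<otimes>\<^bsub>F\<^esub> (V y \<otimes>\<^bsub>F\<^esub> V z)) \<^bold>\<and>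
        (V x \<otimes>\<^bsub>F\<^esub> (V y \<oplus>\<^bsub>F\<^esub> V z) \<^bold>\<doteq> V x \<otimes>\<^bsub>F\<^esub> V y \<oplus>\<^bsub>F\<^esub> V x \<otimes>\<^bsub>F\<^esub> V z)) \<^bold>\<and>
     (\<^bold>\<forall>x\<^bold>\<in>R. \<^bold>\<forall>y\<^bold>\<in>R.
        (V x \<oplus>\<^bsub>F\<^esub> V y \<^bold>\<doteq> V y \<oplus>\<^bsub>F\<^esub> V x) \<^bold>\<and> (V x \<otimes>\<^bsub>F\<^esub> V y \<^bold>\<doteq> V y \<otimes>\<^bsub>F\<^esub> V x)) \<^bold>\<and>
     (\<^bold>\<forall>x\<^bold>\<in>R. (V x \<oplus>\<^bsub>F\<^esub> \<zero>\<^bsub>F\<^esub> \<^bold>\<doteq> V x) \<^bold>\<and> (V x \<otimes>\<^bsub>F\<^esub> \<one>\<^bsub>F\<^esub> \<^bold>\<doteq> V x)) \<^bold>\<and>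
     (\<^bold>\<forall>x\<^bold>\<in>R. \<^bold>\<exists>y\<^bold>\<in>R. V x \<oplus>\<^bsub>F\<^esub> V y \<^bold>\<doteq> \<zero>\<^bsub>F\<^esub>) \<^bold>\<and>
     (\<^bold>\<forall>x\<^bold>\<in>R. \<^bold>\<not> (x \<^bold>= zer F) \<^bold>\<longrightarrow> (\<^bold>\<exists>y\<^bold>\<in>R. V x \<otimes>\<^bsub>F\<^esub> V y \<^bold>\<doteq> \<one>\<^bsub>F\<^esub>)))"

definition is_ordered_field :: "ofield \<Rightarrow> form" where
  "is_ordered_field F = (let R = carr F in
     is_field F \<^bold>\<and>
     (\<^bold>\<forall>p\<^bold>\<in>order F. \<^bold>\<exists>x\<^bold>\<in>R. \<^bold>\<exists>y\<^bold>\<in>R. is_pair p x y) \<^bold>\<and>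
     (\<^bold>\<forall>x\<^bold>\<in>R. \<^bold>\<forall>y\<^bold>\<in>R. (V x \<preceq>\<^bsub>F\<^esub> V y) \<^bold>\<or> (V y \<preceq>\<^bsub>F\<^esub> V x)) \<^bold>\<and>
     (\<^bold>\<forall>x\<^bold>\<in>R. \<^bold>\<forall>y\<^bold>\<in>R. (V x \<preceq>\<^bsub>F\<^esub> V y) \<^bold>\<and> (V y \<preceq>\<^bsub>F\<^esub> V x) \<^bold>\<longrightarrow> x \<^bold>= y) \<^bold>\<and>
     (\<^bold>\<forall>x\<^bold>\<in>R. \<^bold>\<forall>y\<^bold>\<in>R. \<^bold>\<forall>z\<^bold>\<in>R.
        (V x \<preceq>\<^bsub>F\<^esub> V y) \<^bold>\<and> (V y \<preceq>\<^bsub>F\<^esub> V z) \<^bold>\<longrightarrow> (V x \<preceq>\<^bsub>F\<^esub> V z)) \<^bold>\<and>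
     (\<^bold>\<forall>x\<^bold>\<in>R. \<^bold>\<forall>y\<^bold>\<in>R. \<^bold>\<forall>z\<^bold>\<in>R.
        (V x \<preceq>\<^bsub>F\<^esub> V y) \<^bold>\<longrightarrow> (V x \<oplus>\<^bsub>F\<^esub> V z \<preceq>\<^bsub>F\<^esub> V y \<oplus>\<^bsub>F\<^esub> V z)) \<^bold>\<and>
     (\<^bold>\<forall>x\<^bold>\<in>R. \<^bold>\<forall>y\<^bold>\<in>R.
        (\<zero>\<^bsub>F\<^esub> \<preceq>\<^bsub>F\<^esub> V x) \<^bold>\<and> (\<zero>\<^bsub>F\<^esub> \<preceq>\<^bsub>F\<^esub> V y) \<^bold>\<longrightarrow> (\<zero>\<^bsub>F\<^esub> \<preceq>\<^bsub>F\<^esub> V x \<otimes>\<^bsub>F\<^esub> V y)))"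

definition is_upper_bound :: "ofield \<Rightarrow> nat \<Rightarrow> nat \<Rightarrow> form" where
  "is_upper_bound F A b = (b \<^bold>\<in> carr F \<^bold>\<and> (\<^bold>\<forall>x\<^bold>\<in>A. V x \<preceq>\<^bsub>F\<^esub> V b))"

definition is_complete_ordered_field :: "ofield \<Rightarrow> form" where
  "is_complete_ordered_field F =
     (is_ordered_field F \<^bold>\<and>
      (\<^bold>\<forall>A. (\<^bold>\<forall>x\<^bold>\<in>A. x \<^bold>\<in> carr F) \<^bold>\<and> (\<^bold>\<exists>x. x \<^bold>\<in> A) \<^bold>\<and> (\<^bold>\<exists>b. is_upper_bound F A b) \<^bold>\<longrightarrow>
         (\<^bold>\<exists>s. is_upper_bound F A s \<^bold>\<and> (\<^bold>\<forall>b. is_upper_bound F A b \<^bold>\<longrightarrow> (V s \<preceq>\<^bsub>F\<^esub> V b)))))"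

text \<open>Membership in every inductive subset of the field.\<close>

definition is_natural :: "ofield \<Rightarrow> nat \<Rightarrow> form" where
  "is_natural F n =
     (n \<^bold>\<in> carr F \<^bold>\<and>
      (\<^bold>\<forall>I. (\<^bold>\<forall>x\<^bold>\<in>I. x \<^bold>\<in> carr F) \<^bold>\<and> zer F \<^bold>\<in> I \<^bold>\<and>
          (\<^bold>\<forall>x\<^bold>\<in>I. \<^bold>\<exists>y\<^bold>\<in>I. V y \<^bold>\<doteq> V x \<oplus>\<^bsub>F\<^esub> \<one>\<^bsub>F\<^esub>) \<^bold>\<longrightarrow> n \<^bold>\<in> I))"


section \<open>Metric spaces and quasi-isometries\<close>

definition is_metric_space :: "ofield \<Rightarrow> nat \<Rightarrow> nat \<Rightarrow> form" where
  "is_metric_space F S d =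
     (is_binary_function d S (carr F) \<^bold>\<and>
      (\<^bold>\<forall>x\<^bold>\<in>S. \<^bold>\<forall>y\<^bold>\<in>S. \<zero>\<^bsub>F\<^esub> \<preceq>\<^bsub>F\<^esub> app2 d (V x) (V y)) \<^bold>\<and>
      (\<^bold>\<forall>x\<^bold>\<in>S. \<^bold>\<forall>y\<^bold>\<in>S. (app2 d (V x) (V y) \<^bold>\<doteq> \<zero>\<^bsub>F\<^esub>) \<^bold>\<longleftrightarrow> x \<^bold>= y) \<^bold>\<and>
      (\<^bold>\<forall>x\<^bold>\<in>S. \<^bold>\<forall>y\<^bold>\<in>S. app2 d (V x) (V y) \<^bold>\<doteq> app2 d (V y) (V x)) \<^bold>\<and>
      (\<^bold>\<forall>x\<^bold>\<in>S. \<^bold>\<forall>y\<^bold>\<in>S. \<^bold>\<forall>z\<^bold>\<in>S.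
         app2 d (V x) (V z) \<preceq>\<^bsub>F\<^esub> app2 d (V x) (V y) \<oplus>\<^bsub>F\<^esub> app2 d (V y) (V z)))"

text \<open>The number r is the distance from x to the subset J, that is, the greatest lower bound of the
  distances to points of J. For empty J there is no such r, in accordance with the convention
  that the distance is then infinite; no point lies in a neighbourhood of the empty set.\<close>

definition is_set_dist :: "ofield \<Rightarrow> nat \<Rightarrow> nat \<Rightarrow> (nat \<Rightarrow> form) \<Rightarrow> nat \<Rightarrow> form" where
  "is_set_dist F d x J r =
     (r \<^bold>\<in> carr F \<^bold>\<and>
      (\<^bold>\<forall>y. J y \<^bold>\<longrightarrow> (V r \<preceq>\<^bsub>F\<^esub> app2 d (V x) (V y))) \<^bold>\<and>
      (\<^bold>\<forall>q\<^bold>\<in>carr F. (\<^bold>\<forall>y. J y \<^bold>\<longrightarrow> (V q \<preceq>\<^bsub>F\<^esub> app2 d (V x) (V y))) \<^bold>\<longrightarrow> (V q \<preceq>\<^bsub>F\<^esub> V r)))"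

definition in_nbhd :: "ofield \<Rightarrow> nat \<Rightarrow> nat \<Rightarrow> (nat \<Rightarrow> form) \<Rightarrow> nat \<Rightarrow> nat \<Rightarrow> form" where
  "in_nbhd F T d J p x = (x \<^bold>\<in> T \<^bold>\<and> (\<^bold>\<exists>r. is_set_dist F d x J r \<^bold>\<and> (V r \<preceq>\<^bsub>F\<^esub> V p)))"

definition in_range :: "nat \<Rightarrow> nat \<Rightarrow> form" where
  "in_range f y = (\<^bold>\<exists>x. pair_in f x y)"

definition is_quasi_isometry ::
    "ofield \<Rightarrow> nat \<Rightarrow> nat \<Rightarrow> nat \<Rightarrow> nat \<Rightarrow> nat \<Rightarrow> form" where
  "is_quasi_isometry F S dS T dT f =
     (is_function f (elem S) (elem T) \<^bold>\<and>
      (\<^bold>\<exists>N. is_natural F N \<^bold>\<and> (\<one>\<^bsub>F\<^esub> \<preceq>\<^bsub>F\<^esub> V N) \<^bold>\<and>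
         (\<^bold>\<forall>y. in_nbhd F T dT (in_range f) N y \<^bold>\<longleftrightarrow> y \<^bold>\<in> T) \<^bold>\<and>
         (\<^bold>\<forall>x\<^bold>\<in>S. \<^bold>\<forall>y\<^bold>\<in>S.
            ((\<one>\<^bsub>F\<^esub> \<oslash>\<^bsub>F\<^esub> V N) \<otimes>\<^bsub>F\<^esub> app2 dS (V x) (V y) \<ominus>\<^bsub>F\<^esub> V N
               \<preceq>\<^bsub>F\<^esub> app2 dT (app f (V x)) (app f (V y))) \<^bold>\<and>
            (app2 dT (app f (V x)) (app f (V y))
               \<preceq>\<^bsub>F\<^esub> V N \<otimes>\<^bsub>F\<^esub> app2 dS (V x) (V y) \<oplus>\<^bsub>F\<^esub> V N))))"


section \<open>Real trees\<close>

definition in_interval :: "ofield \<Rightarrow> nat \<Rightarrow> nat \<Rightarrow> form" where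
  "in_interval F l s = (s \<^bold>\<in> carr F \<^bold>\<and> (\<zero>\<^bsub>F\<^esub> \<preceq>\<^bsub>F\<^esub> V s) \<^bold>\<and> (V s \<preceq>\<^bsub>F\<^esub> V l))"

definition is_geodesic :: "ofield \<Rightarrow> nat \<Rightarrow> nat \<Rightarrow> nat \<Rightarrow> nat \<Rightarrow> nat \<Rightarrow> form" where
  "is_geodesic F S d x y \<rho> =
     (\<^bold>\<exists>l. (V l \<^bold>\<doteq> app2 d (V x) (V y)) \<^bold>\<and>
        is_function \<rho> (in_interval F l) (elem S) \<^bold>\<and>
        (\<^bold>\<forall>s t. in_interval F l s \<^bold>\<and> in_interval F l t \<^bold>\<longrightarrow>
           (app2 d (app \<rho> (V s)) (app \<rho> (V t)) \<^bold>\<doteq> tAbs F (V s \<ominus>\<^bsub>F\<^esub> V t))) \<^bold>\<and>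
        (app \<rho> \<zero>\<^bsub>F\<^esub> \<^bold>\<doteq> V x) \<^bold>\<and> (app \<rho> (V l) \<^bold>\<doteq> V y))"

definition is_geodesic_space :: "ofield \<Rightarrow> nat \<Rightarrow> nat \<Rightarrow> form" where
  "is_geodesic_space F S d =
     (is_metric_space F S d \<^bold>\<and> (\<^bold>\<forall>x\<^bold>\<in>S. \<^bold>\<forall>y\<^bold>\<in>S. \<^bold>\<exists>\<rho>. is_geodesic F S d x y \<rho>))"

definition is_hyperbolic :: "ofield \<Rightarrow> nat \<Rightarrow> nat \<Rightarrow> nat \<Rightarrow> form" where
  "is_hyperbolic F \<delta> S d =
     (is_geodesic_space F S d \<^bold>\<and>
      (\<^bold>\<forall>x\<^bold>\<in>S. \<^bold>\<forall>y\<^bold>\<in>S. \<^bold>\<forall>z\<^bold>\<in>S. \<^bold>\<forall>\<rho> \<sigma> \<tau>.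
         is_geodesic F S d x y \<rho> \<^bold>\<and> is_geodesic F S d x z \<sigma> \<^bold>\<and> is_geodesic F S d y z \<tau> \<^bold>\<longrightarrow>
         (\<^bold>\<forall>w. in_range \<rho> w \<^bold>\<longrightarrow> in_nbhd F S d (\<lambda>u. in_range \<sigma> u \<^bold>\<or> in_range \<tau> u) \<delta> w)))"

definition is_real_tree :: "ofield \<Rightarrow> nat \<Rightarrow> nat \<Rightarrow> form" where
  "is_real_tree F S d = is_hyperbolic F (zer F) S d"

end

theory Submission
  imports Defs Complex_Main "HOL-Library.Countable_Set"
begin

text \<open>By the completeness theorem it suffices to argue in an arbitrary countable model of ZF. Inside
  the model the only danger is a hidden use of choice. Let f be a quasi-isometry from the tree S to T.
  For t in T, the set A of the points of S that f maps close to t is nonempty and of bounded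
  diameter. Fix a single base point p in S. In a tree, the geodesics from p to the points of A have
  a long common initial part: they agree up to a distance s from p that is the infimum of the
  distances from p to A, less a constant. The point at distance s on these geodesics is within bounded
  distance of all of A and is definable from t, so mapping t to it is a quasi-isometry
  that Separation provides.\<close>


section \<open>Completeness of first-order logic\<close>

text \<open>The usual quasi-inverse picks some point of A for each t, one choice per point of T.
  What makes a canonical point possible is the Gromov product at p: if the distances from p to A
  have infimum m and A has diameter at most k, two points a and b of A satisfy d(p,a) + d(p,b) -
  d(a,b) \<ge> 2m - k, so their geodesics agree up to any s < m - k/2. Taking s = m - (k + 1), or 0
  if this is negative, keeps a strict margin and loses only a bounded distance. The second obstacle
  is the field of the model. It is complete only for sets of the model and may, seen from outside,
  be non-Archimedean, so the reals of HOL cannot stand in for it. Every infimum, every bound by a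
  natural number and every map must therefore come from a set that an explicit formula defines
  inside the model; HOL supplies only the arithmetic of an ordered field.\<close>

lemma ren_ren: "ren r (ren s \<phi>) = ren (r \<circ> s) \<phi>"
proof (induction \<phi> arbitrary: r s)
  case (All \<phi>)
  have "case_nat 0 (\<lambda>i. Suc (r i)) \<circ> case_nat 0 (\<lambda>i. Suc (s i)) = case_nat 0 (\<lambda>i. Suc ((r \<circ> s) i))"
    by (auto split: nat.split)
  then show ?case by (simp only: ren.simps All)
qed simp_all

primrec fv :: "fm \<Rightarrow> nat set" where
  "fv (Mem i j) = {i, j}"
| "fv (Eq i j) = {i, j}"
| "fv Fls = {}"
| "fv (Imp \<phi> \<psi>) = fv \<phi> \<union> fv \<psi>"
| "fv (All \<phi>) = Suc -` fv \<phi>"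

lemma finite_fv: "finite (fv \<phi>)"
  by (induction \<phi>) (auto intro: finite_vimageI)

lemma ren_cong: "(\<And>i. i \<in> fv \<phi> \<Longrightarrow> r i = s i) \<Longrightarrow> ren r \<phi> = ren s \<phi>"
proof (induction \<phi> arbitrary: r s)
  case (All \<phi>)
  have "case_nat 0 (\<lambda>i. Suc (r i)) i = case_nat 0 (\<lambda>i. Suc (s i)) i" if "i \<in> fv \<phi>" for i
    using All.prems that by (cases i) auto
  from All.IH[OF this] show ?case by simp
next
  case (Imp \<phi> \<psi>)
  from Imp.IH(1)[of r s] Imp.IH(2)[of r s] Imp.prems show ?case by simp
qed auto

lemma ren_id: "ren (\<lambda>i. i) \<phi> = \<phi>"
proof (induction \<phi>)
  case (All \<phi>)
  have "case_nat 0 Suc = (\<lambda>i. i)" by (auto split: nat.split)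
  with All show ?case by simp
qed auto

lemma ren_ident: "(\<And>i. i \<in> fv \<phi> \<Longrightarrow> r i = i) \<Longrightarrow> ren r \<phi> = \<phi>"
  using ren_cong[of \<phi> r "\<lambda>i. i"] by (simp add: ren_id)

lemma fv_ren: "fv (ren r \<phi>) = r ` fv \<phi>"
proof (induction \<phi> arbitrary: r)
  case (All \<phi>)
  have "Suc -` case_nat 0 (\<lambda>i. Suc (r i)) ` A = r ` Suc -` A" for A
  proof (intro equalityI subsetI)
    fix i assume "i \<in> Suc -` case_nat 0 (\<lambda>i. Suc (r i)) ` A"
    then obtain j where "j \<in> A" "Suc i = case_nat 0 (\<lambda>i. Suc (r i)) j" by auto
    then show "i \<in> r ` Suc -` A" by (cases j) auto
  qed (auto simp: image_iff intro: bexI[of _ "Suc _"])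
  then show ?case by (simp add: All)
qed auto

text \<open>This holds for arbitrary renamings: in the case of \<open>allI\<close> the lifted
  renaming commutes with the shift, \<open>?r \<circ> Suc = Suc \<circ> r\<close>, so the bound
  variable stays absent from the hypotheses.\<close>

lemma derives_ren: "\<Gamma> \<turnstile> \<phi> \<Longrightarrow> ren r ` \<Gamma> \<turnstile> ren r \<phi>"
proof (induction arbitrary: r rule: derives.induct)
  case (allI \<Gamma> \<phi>)
  let ?r = "case_nat 0 (\<lambda>i. Suc (r i))"
  have "?r \<circ> Suc = Suc \<circ> r" by auto
  then have "ren ?r ` ren Suc ` \<Gamma> = ren Suc ` ren r ` \<Gamma>"
    by (simp add: image_image ren_ren)
  with allI.IH[of ?r] show ?case by (simp add: derives.allI)
next
  case (allE \<Gamma> \<phi> x)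
  have "r \<circ> case_nat x id = case_nat (r x) id \<circ> case_nat 0 (\<lambda>i. Suc (r i))"
    by (auto split: nat.split)
  with derives.allE[OF allE.IH[of r, simplified], of "r x"] show ?case by (simp only: ren_ren)
next
  case (eq_subst \<Gamma> x y \<phi>)
  let ?r = "case_nat 0 (\<lambda>i. Suc (r i))"
  have *: "r \<circ> case_nat x id = case_nat (r x) id \<circ> ?r" for x
    by (auto split: nat.split)
  from eq_subst.IH(2)[of r] have "ren r ` \<Gamma> \<turnstile> ren (case_nat (r x) id) (ren ?r \<phi>)"
    by (simp add: ren_ren *)
  moreover from eq_subst.IH(1)[of r] have "ren r ` \<Gamma> \<turnstile> Eq (r x) (r y)" by simp
  ultimately have "ren r ` \<Gamma> \<turnstile> ren (case_nat (r y) id) (ren ?r \<phi>)" by (rule derives.eq_subst[rotated])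
  then show ?case by (simp add: ren_ren *)
next
  case (impE \<Gamma> \<phi> \<psi>)
  from derives.impE[OF impE.IH(1)[of r, simplified] impE.IH(2)] show ?case .
qed (auto intro: hyp impI raa eq_refl)

lemma derives_mono: "\<Gamma> \<turnstile> \<phi> \<Longrightarrow> \<Gamma> \<subseteq> \<Delta> \<Longrightarrow> \<Delta> \<turnstile> \<phi>"
proof (induction arbitrary: \<Delta> rule: derives.induct)
  case (impI \<phi> \<Gamma> \<psi>)
  from derives.impI[OF impI.IH[OF insert_mono[OF impI.prems]]] show ?case .
next
  case (raa \<phi> \<Gamma>)
  from derives.raa[OF raa.IH[OF insert_mono[OF raa.prems]]] show ?case .
next
  case (allI \<Gamma> \<phi>)
  from derives.allI[OF allI.IH[OF image_mono[OF allI.prems]]] show ?case .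
next
  case (eq_subst \<Gamma> x y \<phi>)
  from derives.eq_subst[OF eq_subst.IH(1) eq_subst.IH(2)] eq_subst.prems show ?case by simp
next
  case (impE \<Gamma> \<phi> \<psi>)
  from derives.impE[OF impE.IH(1) impE.IH(2)] impE.prems show ?case by simp
next
  case (allE \<Gamma> \<phi> x)
  from derives.allE[OF allE.IH] allE.prems show ?case by simp
qed (auto intro: hyp eq_refl)

lemma derives_compact: "\<Gamma> \<turnstile> \<phi> \<Longrightarrow> \<exists>\<Delta>. finite \<Delta> \<and> \<Delta> \<subseteq> \<Gamma> \<and> \<Delta> \<turnstile> \<phi>"
proof (induction rule: derives.induct)
  case (hyp \<phi> \<Gamma>)
  then show ?case by (intro exI[of _ "{\<phi>}"]) (auto intro: derives.hyp)
next
  case (impI \<phi> \<Gamma> \<psi>)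
  then obtain \<Delta> where *: "finite \<Delta>" "\<Delta> \<subseteq> insert \<phi> \<Gamma>" "\<Delta> \<turnstile> \<psi>" by blast
  have "\<Delta> - {\<phi>} \<turnstile> Imp \<phi> \<psi>"
    by (rule derives.impI[OF derives_mono[OF *(3)]]) auto
  with * show ?case by (intro exI[of _ "\<Delta> - {\<phi>}"]) auto
next
  case (impE \<Gamma> \<phi> \<psi>)
  then obtain \<Delta> \<Delta>' where *: "finite \<Delta>" "\<Delta> \<subseteq> \<Gamma>" "\<Delta> \<turnstile> Imp \<phi> \<psi>" "finite \<Delta>'" "\<Delta>' \<subseteq> \<Gamma>" "\<Delta>' \<turnstile> \<phi>"
    by blast
  from derives.impE[OF derives_mono[OF *(3)] derives_mono[OF *(6)], of "\<Delta> \<union> \<Delta>'"] * show ?case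
    by (intro exI[of _ "\<Delta> \<union> \<Delta>'"]) simp
next
  case (raa \<phi> \<Gamma>)
  then obtain \<Delta> where *: "finite \<Delta>" "\<Delta> \<subseteq> insert (Imp \<phi> Fls) \<Gamma>" "\<Delta> \<turnstile> Fls" by blast
  have "\<Delta> - {Imp \<phi> Fls} \<turnstile> \<phi>"
    by (rule derives.raa[OF derives_mono[OF *(3)]]) auto
  with * show ?case by (intro exI[of _ "\<Delta> - {Imp \<phi> Fls}"]) auto
next
  case (allI \<Gamma> \<phi>)
  then obtain \<Delta> where *: "finite \<Delta>" "\<Delta> \<subseteq> ren Suc ` \<Gamma>" "\<Delta> \<turnstile> \<phi>" by blast
  \<comment> \<open>The finitely many premises of \<open>allI\<close> are shifted formulas; they are
    pulled back to finitely many formulas of \<Gamma>.\<close>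
  then obtain \<Delta>' where "\<Delta>' \<subseteq> \<Gamma>" "finite \<Delta>'" "\<Delta> = ren Suc ` \<Delta>'"
    using finite_subset_image by meson
  with derives.allI[of \<Delta>' \<phi>] * show ?case by (intro exI[of _ \<Delta>']) simp
next
  case (allE \<Gamma> \<phi> x)
  then obtain \<Delta> where *: "finite \<Delta>" "\<Delta> \<subseteq> \<Gamma>" "\<Delta> \<turnstile> All \<phi>" by blast
  from derives.allE[OF *(3)] * show ?case by (intro exI[of _ \<Delta>]) simp
next
  case (eq_refl \<Gamma> x)
  from derives.eq_refl[of "{}" x] show ?case by (intro exI[of _ "{}"]) simp
next
  case (eq_subst \<Gamma> x y \<phi>)
  then obtain \<Delta> \<Delta>' where *: "finite \<Delta>" "\<Delta> \<subseteq> \<Gamma>" "\<Delta> \<turnstile> Eq x y" "finite \<Delta>'" "\<Delta>' \<subseteq> \<Gamma>"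
    "\<Delta>' \<turnstile> ren (case_nat x id) \<phi>" by blast
  have "\<Delta> \<union> \<Delta>' \<turnstile> ren (case_nat y id) \<phi>"
    by (rule derives.eq_subst[OF derives_mono[OF *(3)] derives_mono[OF *(6)]]) auto
  with * show ?case by (intro exI[of _ "\<Delta> \<union> \<Delta>'"]) auto
qed

lemma derives_cut: "\<Gamma> \<turnstile> \<phi> \<Longrightarrow> insert \<phi> \<Gamma> \<turnstile> \<psi> \<Longrightarrow> \<Gamma> \<turnstile> \<psi>"
  by (rule impE[OF impI])

text \<open>The renaming that sends x to 0 and shifts all other variables undoes the substitution of x,
  so a derivation about a fresh x becomes one about the bound variable.\<close>

lemma derives_generalize:
  assumes "\<Gamma> \<turnstile> ren (case_nat x id) \<phi>" and "x \<notin> \<Union>(fv ` \<Gamma>)" and "x \<notin> fv (All \<phi>)"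
  shows "\<Gamma> \<turnstile> All \<phi>"
proof -
  let ?r = "\<lambda>i. if i = x then 0 else Suc i"
  have "ren ?r ` \<Gamma> = ren Suc ` \<Gamma>"
    using assms(2) by (intro image_cong refl ren_cong) auto
  moreover have "ren ?r (ren (case_nat x id) \<phi>) = \<phi>"
    unfolding ren_ren using assms(3) by (intro ren_ident) (auto split: nat.split)
  ultimately show ?thesis using derives_ren[OF assms(1), of ?r] by (simp add: allI)
qed

section \<open>Henkin extensions of consistent sets\<close>

abbreviation consistent :: "fm set \<Rightarrow> bool" where
  "consistent \<Gamma> \<equiv> \<not> \<Gamma> \<turnstile> Fls"

instance fm :: countable
  by countable_datatype

text \<open>Variables act as Henkin constants, since the language has none. The only quantifier is
  \<open>All\<close>, so the existential statements in need of a witness are the negated universal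
  ones.\<close>

fun witness :: "nat \<Rightarrow> fm \<Rightarrow> fm set" where
  "witness x (Imp (All \<phi>) Fls) = {Imp (ren (case_nat x id) \<phi>) Fls}"
| "witness x _ = {}"

definition extend :: "fm \<Rightarrow> fm set \<Rightarrow> fm set" where
  "extend \<phi> \<Gamma> = (if consistent (insert \<phi> \<Gamma>)
     then witness (SOME x. x \<notin> \<Union>(fv ` insert \<phi> \<Gamma>)) \<phi> \<union> insert \<phi> \<Gamma> else \<Gamma>)"

primrec henkin :: "fm set \<Rightarrow> nat \<Rightarrow> fm set" where
  "henkin \<Gamma> 0 = \<Gamma>"
| "henkin \<Gamma> (Suc n) = extend (from_nat n) (henkin \<Gamma> n)"

lemma witness_cases:
  "witness x \<phi> = {} \<or> (\<exists>\<psi>. \<phi> = Imp (All \<psi>) Fls \<and> witness x \<phi> = {Imp (ren (case_nat x id) \<psi>) Fls})"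
  by (cases "(x, \<phi>)" rule: witness.cases) auto

lemma extend_invariant:
  assumes "consistent \<Gamma>" and "infinite (- \<Union>(fv ` \<Gamma>))"
  shows "consistent (extend \<phi> \<Gamma>)" and "infinite (- \<Union>(fv ` extend \<phi> \<Gamma>))"
proof -
  define x where "x = (SOME x. x \<notin> \<Union>(fv ` insert \<phi> \<Gamma>))"
  have "infinite (- \<Union>(fv ` \<Gamma>) - fv \<phi>)"
    using assms(2) finite_fv by (rule Diff_infinite_finite[rotated])
  then have inf: "infinite (- \<Union>(fv ` insert \<phi> \<Gamma>))"
    by (rule contrapos_nn) (auto elim: finite_subset[rotated])
  then have "\<exists>x. x \<notin> \<Union>(fv ` insert \<phi> \<Gamma>)"
    using infinite_imp_nonempty by blast
  then have x: "x \<notin> \<Union>(fv ` insert \<phi> \<Gamma>)"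
    unfolding x_def by (rule someI_ex)
  show "consistent (extend \<phi> \<Gamma>)"
  proof (cases "consistent (insert \<phi> \<Gamma>)")
    case True
    show ?thesis
    proof (cases "witness x \<phi> = {}")
      case True
      with \<open>consistent (insert \<phi> \<Gamma>)\<close> show ?thesis by (simp add: extend_def x_def del: fv.simps)
    next
      case False
      then obtain \<psi> where \<psi>: "\<phi> = Imp (All \<psi>) Fls"
        and w: "witness x \<phi> = {Imp (ren (case_nat x id) \<psi>) Fls}"
        using witness_cases by blast
      have "extend \<phi> \<Gamma> = insert (Imp (ren (case_nat x id) \<psi>) Fls) (insert \<phi> \<Gamma>)"
        using True w by (simp add: extend_def x_def insert_commute del: fv.simps)
      moreover have "consistent (insert (Imp (ren (case_nat x id) \<psi>) Fls) (insert \<phi> \<Gamma>))"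
      proof
        assume "insert (Imp (ren (case_nat x id) \<psi>) Fls) (insert \<phi> \<Gamma>) \<turnstile> Fls"
        then have "insert \<phi> \<Gamma> \<turnstile> ren (case_nat x id) \<psi>" by (rule raa)
        then have "insert \<phi> \<Gamma> \<turnstile> All \<psi>"
          using x \<psi> by (intro derives_generalize) auto
        then have "insert \<phi> \<Gamma> \<turnstile> Fls"
          by (rule impE[OF hyp, rotated]) (simp add: \<psi>)
        with True show False ..
      qed
      ultimately show ?thesis by simp
    qed
  qed (use assms in \<open>simp add: extend_def\<close>)
  show "infinite (- \<Union>(fv ` extend \<phi> \<Gamma>))"
  proof (cases "consistent (insert \<phi> \<Gamma>)")
    case True
    have "finite (\<Union>(fv ` witness x \<phi>))"
      using witness_cases[of x \<phi>] by (elim disjE exE conjE) (simp_all add: finite_fv del: fv.simps)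
    with inf have "infinite (- \<Union>(fv ` insert \<phi> \<Gamma>) - \<Union>(fv ` witness x \<phi>))"
      by (rule Diff_infinite_finite[rotated])
    moreover have "extend \<phi> \<Gamma> = witness x \<phi> \<union> insert \<phi> \<Gamma>"
      using True by (simp only: extend_def x_def if_True not_False_eq_True)
    then have "- \<Union>(fv ` insert \<phi> \<Gamma>) - \<Union>(fv ` witness x \<phi>) \<subseteq> - \<Union>(fv ` extend \<phi> \<Gamma>)"
      by blast
    ultimately show ?thesis using finite_subset by blast
  qed (use assms in \<open>simp add: extend_def\<close>)
qed

lemma henkin_invariant:
  assumes "consistent \<Gamma>" and "infinite (- \<Union>(fv ` \<Gamma>))"
  shows "consistent (henkin \<Gamma> n) \<and> infinite (- \<Union>(fv ` henkin \<Gamma> n))"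
proof (induction n)
  case (Suc n)
  then show ?case unfolding henkin.simps using extend_invariant by blast
qed (use assms in \<open>simp only: henkin.simps, blast\<close>)

lemma henkin_mono: "m \<le> n \<Longrightarrow> henkin \<Gamma> m \<subseteq> henkin \<Gamma> n"
  by (rule lift_Suc_mono_le[of "henkin \<Gamma>"]) (auto simp: extend_def)

theorem henkin_extension:
  assumes "consistent \<Gamma>" and "infinite (- \<Union>(fv ` \<Gamma>))"
  obtains H where "\<Gamma> \<subseteq> H" and "consistent H" and "\<And>\<phi>. H \<turnstile> \<phi> \<Longrightarrow> \<phi> \<in> H"
    and "\<And>\<phi>. \<phi> \<in> H \<or> Imp \<phi> Fls \<in> H"
    and "\<And>\<phi>. Imp (All \<phi>) Fls \<in> H \<Longrightarrow> \<exists>x. Imp (ren (case_nat x id) \<phi>) Fls \<in> H"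
proof
  let ?H = "\<Union>(range (henkin \<Gamma>))"
  note inv = henkin_invariant[OF assms]
  show cons: "consistent ?H"
  proof
    assume "?H \<turnstile> Fls"
    then obtain \<Delta> where \<Delta>: "finite \<Delta>" "\<Delta> \<subseteq> ?H" "\<Delta> \<turnstile> Fls"
      using derives_compact by blast
    have "\<exists>n. \<Delta> \<subseteq> henkin \<Gamma> n"
      using \<Delta>(1,2)
    proof (induction rule: finite_induct)
      case (insert \<phi> \<Delta>)
      then obtain m n where "\<Delta> \<subseteq> henkin \<Gamma> m" "\<phi> \<in> henkin \<Gamma> n" by auto
      then have "insert \<phi> \<Delta> \<subseteq> henkin \<Gamma> (max m n)"
        using henkin_mono[of m "max m n" \<Gamma>] henkin_mono[of n "max m n" \<Gamma>] by auto
      then show ?case ..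
    qed simp
    with \<Delta>(3) inv derives_mono show False by blast
  qed
  \<comment> \<open>A formula consistent with the union is also consistent with the smaller set at
    stage \<open>to_nat \<phi>\<close>, where its turn comes, so it is added there.\<close>
  have max: "\<phi> \<in> extend \<phi> (henkin \<Gamma> (to_nat \<phi>))" "consistent (insert \<phi> (henkin \<Gamma> (to_nat \<phi>)))"
    if "consistent (insert \<phi> ?H)" for \<phi>
  proof -
    show "consistent (insert \<phi> (henkin \<Gamma> (to_nat \<phi>)))"
      using that by (rule contrapos_nn) (auto elim: derives_mono)
    then show "\<phi> \<in> extend \<phi> (henkin \<Gamma> (to_nat \<phi>))"
      by (simp add: extend_def)
  qed
  have ext: "extend \<phi> (henkin \<Gamma> (to_nat \<phi>)) \<subseteq> ?H" for \<phi>
    using henkin.simps(2)[of \<Gamma> "to_nat \<phi>"] by (metis UN_upper UNIV_I from_nat_to_nat)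
  show closed: "\<phi> \<in> ?H" if "?H \<turnstile> \<phi>" for \<phi>
  proof -
    have "consistent (insert \<phi> ?H)" using derives_cut[OF that] cons by blast
    then show ?thesis using max(1) ext by blast
  qed
  show "\<phi> \<in> ?H \<or> Imp \<phi> Fls \<in> ?H" for \<phi>
  proof (cases "consistent (insert \<phi> ?H)")
    case True
    then show ?thesis using max(1) ext by blast
  next
    case False
    then show ?thesis using closed[OF impI] by blast
  qed
  show "\<exists>x. Imp (ren (case_nat x id) \<phi>) Fls \<in> ?H" if "Imp (All \<phi>) Fls \<in> ?H" for \<phi>
  proof -
    let ?\<psi> = "Imp (All \<phi>) Fls"
    have "consistent (insert ?\<psi> ?H)"
      using that cons by (simp add: insert_absorb)
    note * = max(2)[OF this] ext[of ?\<psi>]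
    then have "witness (SOME x. x \<notin> \<Union>(fv ` insert ?\<psi> (henkin \<Gamma> (to_nat ?\<psi>)))) ?\<psi> \<subseteq> ?H"
      unfolding extend_def by (simp del: fv.simps)
    then show ?thesis by auto
  qed
  show "\<Gamma> \<subseteq> ?H"
    using UN_upper[of 0 UNIV "henkin \<Gamma>"] by simp
qed

section \<open>The term model\<close>

primrec sat :: "'a set \<Rightarrow> ('a \<Rightarrow> 'a \<Rightarrow> bool) \<Rightarrow> (nat \<Rightarrow> 'a) \<Rightarrow> fm \<Rightarrow> bool" where
  "sat D E e (Mem i j) \<longleftrightarrow> E (e i) (e j)"
| "sat D E e (Eq i j) \<longleftrightarrow> e i = e j"
| "sat D E e Fls \<longleftrightarrow> False"
| "sat D E e (Imp \<phi> \<psi>) \<longleftrightarrow> (sat D E e \<phi> \<longrightarrow> sat D E e \<psi>)"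
| "sat D E e (All \<phi>) \<longleftrightarrow> (\<forall>x\<in>D. sat D E (case_nat x e) \<phi>)"

text \<open>The model consists of the variables modulo the equations in a Henkin extension H.
  Variables are the only terms, so they exhaust the term model and its domain is countable.\<close>

theorem model_existence:
  fixes \<Gamma> :: "fm set"
  assumes "consistent \<Gamma>"
  obtains D :: "nat set set" and E e where "countable D" and "range e \<subseteq> D" and "\<And>\<phi>. \<phi> \<in> \<Gamma> \<Longrightarrow> sat D E e \<phi>"
proof -
  \<comment> \<open>After doubling all variables, the odd ones are fresh and can serve as witnesses.\<close>
  let ?\<Gamma> = "ren (\<lambda>i. 2 * i) ` \<Gamma>"
  have "ren (\<lambda>i. i div 2) (ren (\<lambda>i. 2 * i) \<phi>) = \<phi>" for \<phi>
    by (simp add: ren_ren ren_ident)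
  then have "ren (\<lambda>i. i div 2) ` ?\<Gamma> = \<Gamma>"
    by (simp add: image_image)
  with assms have cons: "consistent ?\<Gamma>"
    using derives_ren[of ?\<Gamma> Fls "\<lambda>i. i div 2"] by auto
  have "range (\<lambda>i. Suc (2 * i)) \<subseteq> - \<Union>(fv ` ?\<Gamma>)"
    by (auto simp: fv_ren) presburger
  moreover have "infinite (range (\<lambda>i. Suc (2 * i)))"
    by (intro range_inj_infinite injI) auto
  ultimately have "infinite (- \<Union>(fv ` ?\<Gamma>))"
    using finite_subset by blast
  with cons obtain H where H: "?\<Gamma> \<subseteq> H" "consistent H" "\<And>\<phi>. H \<turnstile> \<phi> \<Longrightarrow> \<phi> \<in> H"
    "\<And>\<phi>. \<phi> \<in> H \<or> Imp \<phi> Fls \<in> H"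
    "\<And>\<phi>. Imp (All \<phi>) Fls \<in> H \<Longrightarrow> \<exists>x. Imp (ren (case_nat x id) \<phi>) Fls \<in> H"
    using henkin_extension[of ?\<Gamma>] by blast
  have imp: "Imp \<phi> \<psi> \<in> H \<longleftrightarrow> (\<phi> \<in> H \<longrightarrow> \<psi> \<in> H)" for \<phi> \<psi>
  proof
    assume R: "\<phi> \<in> H \<longrightarrow> \<psi> \<in> H"
    show "Imp \<phi> \<psi> \<in> H"
    proof (cases "\<phi> \<in> H")
      case True
      with R have "insert \<phi> H \<turnstile> \<psi>" by (simp add: hyp)
      then show ?thesis by (rule H(3)[OF impI])
    next
      case False
      then have "Imp \<phi> Fls \<in> H" using H(4) by blast
      then have "insert (Imp \<psi> Fls) (insert \<phi> H) \<turnstile> Fls"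
        by (intro impE[OF hyp hyp, of \<phi>]) simp_all
      then show ?thesis by (rule H(3)[OF impI[OF raa]])
    qed
  next
    assume "Imp \<phi> \<psi> \<in> H"
    then show "\<phi> \<in> H \<longrightarrow> \<psi> \<in> H" using H(3) impE[OF hyp hyp] by blast
  qed
  have fls: "Fls \<notin> H" using H(2) hyp by blast
  have all: "All \<phi> \<in> H \<longleftrightarrow> (\<forall>x. ren (case_nat x id) \<phi> \<in> H)" for \<phi>
    using H(3)[OF allE[OF hyp]] H(4)[of "All \<phi>"] H(5)[of \<phi>] fls imp by blast
  have subst: "ren (case_nat y id) \<phi> \<in> H" if "Eq x y \<in> H" "ren (case_nat x id) \<phi> \<in> H" for x y \<phi>
    by (rule H(3)[OF eq_subst[OF hyp hyp]]) (rule that)+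
  have refl: "Eq x x \<in> H" for x
    using H(3) eq_refl by blast
  \<comment> \<open>In these substitutions index 0 marks the replaced place, while a variable y that
    stays is written \<open>Suc y\<close>, since the substitution lowers it by one.\<close>
  have sym: "Eq y x \<in> H" if "Eq x y \<in> H" for x y
    using subst[OF that, of "Eq 0 (Suc x)"] refl by simp
  have trans: "Eq x z \<in> H" if "Eq x y \<in> H" "Eq y z \<in> H" for x y z
    using subst[OF that(2), of "Eq (Suc x) 0"] that(1) by simp
  have mem: "Mem x' y' \<in> H" if "Eq x x' \<in> H" "Eq y y' \<in> H" "Mem x y \<in> H" for x y x' y'
    using subst[OF that(1), of "Mem 0 (Suc y)"] subst[OF that(2), of "Mem (Suc x') 0"] that(3) by simp
  define cls where "cls x = {y. Eq x y \<in> H}" for x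
  have cls: "cls x = cls y \<longleftrightarrow> Eq x y \<in> H" for x y
    unfolding cls_def using refl sym trans by blast
  define E where "E X Y \<longleftrightarrow> (\<exists>x y. X = cls x \<and> Y = cls y \<and> Mem x y \<in> H)" for X Y
  have E: "E (cls x) (cls y) \<longleftrightarrow> Mem x y \<in> H" for x y
    unfolding E_def cls using refl sym mem by blast
  \<comment> \<open>The induction needs every renaming r: instantiating the quantifier by the
    variable x turns r into \<open>case_nat x r\<close>.\<close>
  have truth: "sat (range cls) E (\<lambda>i. cls (r i)) \<phi> \<longleftrightarrow> ren r \<phi> \<in> H" for r \<phi>
  proof (induction \<phi> arbitrary: r)
    case (All \<phi>)
    have "case_nat (cls x) (\<lambda>i. cls (r i)) = (\<lambda>i. cls (case_nat x r i))" for x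
      by (rule ext) (simp split: nat.split)
    moreover have "case_nat x id \<circ> case_nat 0 (\<lambda>i. Suc (r i)) = case_nat x r" for x
      by (auto split: nat.split)
    ultimately show ?case by (simp add: All all ren_ren)
  qed (auto simp: E cls fls imp)
  show thesis
  proof
    show "countable (range cls)" by simp
    show "range (\<lambda>i. cls (2 * i)) \<subseteq> range cls" by auto
    show "sat (range cls) E (\<lambda>i. cls (2 * i)) \<phi>" if "\<phi> \<in> \<Gamma>" for \<phi>
      using H(1) that by (auto simp: truth)
  qed
qed

text \<open>This moves a countably infinite domain to the whole type \<open>nat\<close>, so that
  quantifiers of a model may range over \<open>UNIV\<close>.\<close>

lemma sat_bij:
  assumes "bij_betw h D D'" and "range e \<subseteq> D"
  shows "sat D' (\<lambda>x y. E (the_inv_into D h x) (the_inv_into D h y)) (\<lambda>i. h (e i)) \<phi> \<longleftrightarrow> sat D E e \<phi>"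
  using assms(2)
proof (induction \<phi> arbitrary: e)
  case (Mem i j)
  with assms(1) show ?case by (simp add: bij_betw_def the_inv_into_f_f range_subsetD)
next
  case (Eq i j)
  then have "e i \<in> D" "e j \<in> D" by auto
  with assms(1) show ?case by (auto simp: bij_betw_def dest: inj_onD)
next
  case (All \<phi>)
  have "case_nat (h x) (\<lambda>i. h (e i)) = (\<lambda>i. h (case_nat x e i))" for x
    by (rule ext) (simp split: nat.split)
  moreover have "range (case_nat x e) \<subseteq> D" if "x \<in> D" for x
    using that All.prems[THEN subsetD, OF rangeI] by (auto split: nat.split)
  moreover have "D' = h ` D" using assms(1) by (simp add: bij_betw_def)
  ultimately have "sat D' (\<lambda>x y. E (the_inv_into D h x) (the_inv_into D h y)) (case_nat (h x) (\<lambda>i. h (e i))) \<phi>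
      \<longleftrightarrow> sat D E (case_nat x e) \<phi>" if "x \<in> D" for x
    using All.IH[of "case_nat x e"] that by simp
  with \<open>D' = h ` D\<close> show ?case by simp
qed auto


section \<open>Models of ZF\<close>

text \<open>\<open>env d v e\<close> turns an assignment v of values to levels into one to de Bruijn indices at
  depth d; the indices that point beyond the d quantifiers take their values from e.\<close>

definition env :: "nat \<Rightarrow> (nat \<Rightarrow> 'a) \<Rightarrow> (nat \<Rightarrow> 'a) \<Rightarrow> nat \<Rightarrow> 'a" where
  "env d v e i = (if i < d then v (d - Suc i) else e (i - d))"

lemma env_level: "x < d \<Longrightarrow> env d v e (d - Suc x) = v x"
  by (simp add: env_def)

lemma env_update: "env (Suc d) (v(d := a)) e = case_nat a (env d v e)"
  by (auto simp: env_def fun_eq_iff split: nat.split)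

lemma env_cong: "(\<And>i. i < d \<Longrightarrow> v i = w i) \<Longrightarrow> env d v e = env d w e"
  by (auto simp: env_def fun_eq_iff)

lemma sat_free_below:
  "free_below n \<phi> \<Longrightarrow> (\<And>i. i < n \<Longrightarrow> s i = t i) \<Longrightarrow> sat D E s \<phi> \<longleftrightarrow> sat D E t \<phi>"
proof (induction \<phi> arbitrary: n s t)
  case (Imp \<phi> \<psi>)
  from Imp.IH(1)[of n s t] Imp.IH(2)[of n s t] Imp.prems show ?case by simp
next
  case (All \<phi>)
  have "sat D E (case_nat x s) \<phi> \<longleftrightarrow> sat D E (case_nat x t) \<phi>" for x
    using All.prems by (intro All.IH[of "Suc n"]) (auto split: nat.split)
  then show ?case by simp
qed simp_all

lemma free_below_mono: "free_below m \<phi> \<Longrightarrow> m \<le> n \<Longrightarrow> free_below n \<phi>"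
proof (induction \<phi> arbitrary: m n)
  case (Imp \<phi> \<psi>)
  from Imp.IH[of m n] Imp.prems show ?case by simp
next
  case (All \<phi>)
  from All.IH[of "Suc m" "Suc n"] All.prems show ?case by simp
qed auto

lemma ex_free_below: "\<exists>n. free_below n \<phi>"
proof (induction \<phi>)
  case (Mem i j)
  show ?case by (rule exI[of _ "Suc (max i j)"]) auto
next
  case (Eq i j)
  show ?case by (rule exI[of _ "Suc (max i j)"]) auto
next
  case (Imp \<phi> \<psi>)
  then obtain m n where "free_below m \<phi>" "free_below n \<psi>" by blast
  then have "free_below (max m n) (Imp \<phi> \<psi>)" by (auto intro: free_below_mono)
  then show ?case ..
next
  case (All \<phi>)
  then obtain n where "free_below n \<phi>" by blast
  then have "free_below n (All \<phi>)" by (auto elim: free_below_mono)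
  then show ?case ..
qed simp

lemma sat_ren: "sat D E s (ren r \<phi>) \<longleftrightarrow> sat D E (\<lambda>i. s (r i)) \<phi>"
proof (induction \<phi> arbitrary: s r)
  case (All \<phi>)
  have "(\<lambda>i. case_nat x s (case_nat 0 (\<lambda>i. Suc (r i)) i)) = case_nat x (\<lambda>i. s (r i))" for x
    by (rule ext) (simp split: nat.split)
  then show ?case by (simp only: ren.simps sat.simps All)
qed simp_all

section \<open>Evaluation of formulas with named levels\<close>

locale set_model =
  fixes E :: "'m \<Rightarrow> 'm \<Rightarrow> bool" and e :: "nat \<Rightarrow> 'm"
begin

definition holds :: "nat \<Rightarrow> (nat \<Rightarrow> 'm) \<Rightarrow> form \<Rightarrow> bool" where
  "holds d v P \<longleftrightarrow> sat UNIV E (env d v e) (P d)"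

lemma holds_cong: "(\<And>i. i < d \<Longrightarrow> v i = w i) \<Longrightarrow> holds d v P \<longleftrightarrow> holds d w P"
  using env_cong[of d v w e] by (simp add: holds_def)

text \<open>A quantifier met at depth d binds level d, so it becomes an update of v at d. Used for
  rewriting, these rules translate object-level formulas into HOL without any de Bruijn
  indices.\<close>

lemma holds_connectives [simp]:
  "x < d \<Longrightarrow> y < d \<Longrightarrow> holds d v (x \<^bold>\<in> y) \<longleftrightarrow> E (v x) (v y)"
  "x < d \<Longrightarrow> y < d \<Longrightarrow> holds d v (x \<^bold>= y) \<longleftrightarrow> v x = v y"
  "holds d v (P \<^bold>\<longrightarrow> Q) \<longleftrightarrow> (holds d v P \<longrightarrow> holds d v Q)"
  "holds d v (\<^bold>\<not> P) \<longleftrightarrow> \<not> holds d v P"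
  "holds d v (P \<^bold>\<or> Q) \<longleftrightarrow> holds d v P \<or> holds d v Q"
  "holds d v (P \<^bold>\<and> Q) \<longleftrightarrow> holds d v P \<and> holds d v Q"
  "holds d v (P \<^bold>\<longleftrightarrow> Q) \<longleftrightarrow> (holds d v P \<longleftrightarrow> holds d v Q)"
  "holds d v (\<^bold>\<forall>x. S x) \<longleftrightarrow> (\<forall>a. holds (Suc d) (v(d := a)) (S d))"
  "holds d v (\<^bold>\<exists>x. S x) \<longleftrightarrow> (\<exists>a. holds (Suc d) (v(d := a)) (S d))"
  by (auto simp: holds_def fMem_def fEq_def fImp_def fNot_def fOr_def fAnd_def fIff_def fAll_def
      fEx_def env_level env_update)

lemma holds_bounded [simp]:
  "A < d \<Longrightarrow> holds d v (\<^bold>\<forall>x\<^bold>\<in>A. S x) \<longleftrightarrow> (\<forall>a. E a (v A) \<longrightarrow> holds (Suc d) (v(d := a)) (S d))"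
  "A < d \<Longrightarrow> holds d v (\<^bold>\<exists>x\<^bold>\<in>A. S x) \<longleftrightarrow> (\<exists>a. E a (v A) \<and> holds (Suc d) (v(d := a)) (S d))"
  by (simp_all add: fBall_def fBex_def)

lemma holds_plug:
  assumes "free_below n \<phi>" and "\<And>i. i < n \<Longrightarrow> xs ! i < d"
  shows "holds d v (plug \<phi> xs) \<longleftrightarrow> sat UNIV E (\<lambda>i. v (xs ! i)) \<phi>"
  unfolding holds_def plug_def sat_ren
  using assms(1) by (rule sat_free_below) (simp add: assms(2) env_level)

text \<open>The parameters of an axiom scheme are instantiated all at once: the n quantifiers bind
  the levels d, ..., d + n - 1, and w supplies their values.\<close>

lemma holds_fAlls:
  "holds d v (fAlls n P) \<Longrightarrow> (\<And>i. i < d \<Longrightarrow> w i = v i) \<Longrightarrow> holds (d + n) w (P [d..<d + n])"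
proof (induction n arbitrary: d v P)
  case 0
  then show ?case using holds_cong[of d w v] by simp
next
  case (Suc n)
  have "holds (Suc d) (v(d := w d)) (fAlls n (\<lambda>xs. P (d # xs)))"
    using Suc.prems(1) by simp
  then have "holds (Suc d + n) w (P (d # [Suc d..<Suc d + n]))"
    by (rule Suc.IH) (use Suc.prems(2) in \<open>auto simp: less_Suc_eq\<close>)
  moreover have "[d..<d + Suc n] = d # [Suc d..<Suc d + n]"
    by (simp add: upt_conv_Cons del: upt_Suc)
  ultimately show ?case by (simp del: upt_Suc)
qed

end

locale ZF_model = set_model E e
  for E :: "'m \<Rightarrow> 'm \<Rightarrow> bool" and e :: "nat \<Rightarrow> 'm" +
  assumes model: "\<phi> \<in> ZF \<Longrightarrow> sat UNIV E e \<phi>"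
begin

lemma holds_axiom: "close P \<in> ZF \<Longrightarrow> holds 0 v P"
proof -
  have "env 0 v e = e" by (rule ext) (simp add: env_def)
  then show "close P \<in> ZF \<Longrightarrow> holds 0 v P"
    using model[of "close P"] by (simp add: holds_def close_def)
qed

lemma extensionality: "(\<And>z. E z x \<longleftrightarrow> E z y) \<Longrightarrow> x = y"
proof -
  have "close Defs.extensionality \<in> ZF" by (simp add: ZF_def)
  from holds_axiom[OF this, of undefined] show "(\<And>z. E z x \<longleftrightarrow> E z y) \<Longrightarrow> x = y"
    by (simp add: Defs.extensionality_def)
qed

text \<open>A formula has finitely many free variables, so n can be taken large enough to make all
  of them but 0 parameters, with values given by s. In the instance the parameters occupy the levels
  below n, followed by a, b and x.\<close>

lemma separation_sat: "\<exists>b. \<forall>x. E x b \<longleftrightarrow> E x a \<and> sat UNIV E (case_nat x s) \<phi>"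
proof -
  obtain n where n: "free_below (Suc n) \<phi>"
    using ex_free_below free_below_mono le_SucI by blast
  then have "close (separation n \<phi>) \<in> ZF" unfolding ZF_def by blast
  from holds_fAlls[OF holds_axiom[OF this, of undefined, unfolded separation_def], of s]
  have "\<exists>b. \<forall>x. E x b \<longleftrightarrow> E x a \<and>
    holds (Suc (Suc (Suc n))) (s(n := a, Suc n := b, Suc (Suc n) := x)) (plug \<phi> (Suc (Suc n) # [0..<n]))"
    by simp
  moreover have "holds (Suc (Suc (Suc n))) (s(n := a, Suc n := b, Suc (Suc n) := x)) (plug \<phi> (Suc (Suc n) # [0..<n]))
      \<longleftrightarrow> sat UNIV E (case_nat x s) \<phi>" for b x
    apply (subst holds_plug[OF n])
    subgoal for i by (cases i) auto
    apply (rule sat_free_below[OF n])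
    subgoal for i by (cases i) auto
    done
  ultimately show ?thesis by simp
qed

lemma separation: "\<exists>b. \<forall>x. E x b \<longleftrightarrow> E x a \<and> holds (Suc d) (v(d := x)) P"
  unfolding holds_def env_update by (rule separation_sat)

section \<open>Pairs, products and functions in a model\<close>

definition up :: "'m \<Rightarrow> 'm \<Rightarrow> 'm" where
  "up x y = (THE p. \<forall>z. E z p \<longleftrightarrow> z = x \<or> z = y)"

lemma mem_up [simp]: "E z (up x y) \<longleftrightarrow> z = x \<or> z = y"
proof -
  have "close pairing \<in> ZF" by (simp add: ZF_def)
  from holds_axiom[OF this, of undefined] have "\<forall>x y. \<exists>p. \<forall>z. E z p \<longleftrightarrow> z = x \<or> z = y"
    by (simp add: pairing_def)
  then obtain p where p: "\<forall>z. E z p \<longleftrightarrow> z = x \<or> z = y" by blast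
  then have "\<forall>z. E z (up x y) \<longleftrightarrow> z = x \<or> z = y"
    unfolding up_def by (rule theI) (use p extensionality in blast)
  then show ?thesis by simp
qed

lemma eq_up_iff: "(\<forall>z. E z p \<longleftrightarrow> z = x \<or> z = y) \<longleftrightarrow> p = up x y"
  using extensionality[of p "up x y"] by auto

definition pr :: "'m \<Rightarrow> 'm \<Rightarrow> 'm" where
  "pr x y = up (up x x) (up x y)"

lemma up_eq_iff: "up x y = up x' y' \<longleftrightarrow> x = x' \<and> y = y' \<or> x = y' \<and> y = x'"
proof
  assume "up x y = up x' y'"
  then have "z = x \<or> z = y \<longleftrightarrow> z = x' \<or> z = y'" for z
    using mem_up[of z x y] mem_up[of z x' y'] by simp
  then show "x = x' \<and> y = y' \<or> x = y' \<and> y = x'" by metis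
next
  have "up y x = up x y" by (rule extensionality) auto
  then show "x = x' \<and> y = y' \<or> x = y' \<and> y = x' \<Longrightarrow> up x y = up x' y'" by auto
qed

lemma pr_inject [simp]: "pr x y = pr x' y' \<longleftrightarrow> x = x' \<and> y = y'"
  by (auto simp: pr_def up_eq_iff)

lemma eq_pr_iff: "(\<forall>z. E z p \<longleftrightarrow> z = up x x \<or> z = up x y) \<longleftrightarrow> p = pr x y"
  unfolding eq_up_iff pr_def ..

text \<open>The double power set of the union of a and b serves as c. A superset of the product is
  enough, as graphs are cut out of it by Separation afterwards.\<close>

lemma product_exists: "\<exists>c. \<forall>x y. E x a \<longrightarrow> E y b \<longrightarrow> E (pr x y) c"
proof -
  have "close union_ax \<in> ZF" by (simp add: ZF_def)
  from holds_axiom[OF this, of undefined]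
  have "\<exists>u. \<forall>x. E x u \<longleftrightarrow> (\<exists>y. E y w \<and> E x y)" for w
    by (simp add: union_ax_def)
  from this[of "up a b"] obtain u where u: "\<And>x. E x u \<longleftrightarrow> E x a \<or> E x b" by auto
  have "close power_set \<in> ZF" by (simp add: ZF_def)
  from holds_axiom[OF this, of undefined]
  have P: "\<exists>p. \<forall>x. E x p \<longleftrightarrow> (\<forall>y. E y x \<longrightarrow> E y w)" for w
    by (simp add: power_set_def)
  obtain p where p: "\<And>x. E x p \<longleftrightarrow> (\<forall>y. E y x \<longrightarrow> E y u)" using P by blast
  obtain c where c: "\<And>x. E x c \<longleftrightarrow> (\<forall>y. E y x \<longrightarrow> E y p)" using P by blast
  show ?thesis
    by (rule exI[of _ c]) (auto simp: pr_def c p u)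
qed

lemma holds_is_upair [simp]:
  "p < d \<Longrightarrow> x < d \<Longrightarrow> y < d \<Longrightarrow> holds d v (is_upair p x y) \<longleftrightarrow> v p = up (v x) (v y)"
  using eq_up_iff by (simp add: is_upair_def)

lemma holds_is_pair [simp]:
  "p < d \<Longrightarrow> x < d \<Longrightarrow> y < d \<Longrightarrow> holds d v (is_pair p x y) \<longleftrightarrow> v p = pr (v x) (v y)"
  using eq_pr_iff by (simp add: is_pair_def)

lemma holds_pair_in [simp]:
  "f < d \<Longrightarrow> x < d \<Longrightarrow> y < d \<Longrightarrow> holds d v (pair_in f x y) \<longleftrightarrow> E (pr (v x) (v y)) (v f)"
  by (auto simp: pair_in_def)

lemma holds_triple_in [simp]:
  "f < d \<Longrightarrow> x < d \<Longrightarrow> y < d \<Longrightarrow> z < d \<Longrightarrow>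
    holds d v (triple_in f x y z) \<longleftrightarrow> E (pr (pr (v x) (v y)) (v z)) (v f)"
  by (auto simp: triple_in_def)

lemma holds_elem [simp]: "A < d \<Longrightarrow> x < d \<Longrightarrow> holds d v (elem A x) \<longleftrightarrow> E (v x) (v A)"
  by (simp add: elem_def)

lemma holds_in_range [simp]: "f < d \<Longrightarrow> y < d \<Longrightarrow> holds d v (in_range f y) \<longleftrightarrow> (\<exists>x. E (pr x (v y)) (v f))"
  by (simp add: in_range_def)

text \<open>A formula with one free place may occur under further quantifiers, that is, at a larger depth
  and under an assignment that extends the given one.\<close>

definition denotes :: "nat \<Rightarrow> (nat \<Rightarrow> 'm) \<Rightarrow> (nat \<Rightarrow> form) \<Rightarrow> 'm set \<Rightarrow> bool" where
  "denotes d v A X \<longleftrightarrow> (\<forall>d' w x. d \<le> d' \<longrightarrow> (\<forall>i<d. w i = v i) \<longrightarrow> x < d' \<longrightarrow>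
     (holds d' w (A x) \<longleftrightarrow> w x \<in> X))"

lemma denotesD:
  "denotes d v A X \<Longrightarrow> d \<le> d' \<Longrightarrow> (\<And>i. i < d \<Longrightarrow> w i = v i) \<Longrightarrow> x < d' \<Longrightarrow> holds d' w (A x) \<longleftrightarrow> w x \<in> X"
  by (simp add: denotes_def)

definition fun_on :: "'m \<Rightarrow> 'm set \<Rightarrow> 'm set \<Rightarrow> bool" where
  "fun_on f A B \<longleftrightarrow> (\<forall>p. E p f \<longrightarrow> (\<exists>x\<in>A. \<exists>y\<in>B. p = pr x y)) \<and>
     (\<forall>x\<in>A. \<exists>y. E (pr x y) f) \<and> (\<forall>x y z. E (pr x y) f \<and> E (pr x z) f \<longrightarrow> y = z)"

lemma holds_is_function:
  assumes "f < d" and A: "denotes d v A X" and B: "denotes d v B Y"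
  shows "holds d v (is_function f A B) \<longleftrightarrow> fun_on (v f) X Y"
proof -
  note [simp] = denotesD[OF A] denotesD[OF B]
  show ?thesis using \<open>f < d\<close> by (simp add: is_function_def fun_on_def Bex_def Ball_def)
qed

lemma fun_onE:
  assumes "fun_on f A B"
  obtains h where "\<And>x y. E (pr x y) f \<longleftrightarrow> x \<in> A \<and> y = h x" and "h ` A \<subseteq> B"
proof
  let ?h = "\<lambda>x. THE y. E (pr x y) f"
  have *: "E (pr x y) f \<Longrightarrow> ?h x = y" for x y
    using assms unfolding fun_on_def by blast
  have dom: "E (pr x y) f \<Longrightarrow> x \<in> A \<and> y \<in> B" for x y
    using assms unfolding fun_on_def by fastforce
  have tot: "x \<in> A \<Longrightarrow> \<exists>y. E (pr x y) f" for x
    using assms unfolding fun_on_def by blast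
  show "E (pr x y) f \<longleftrightarrow> x \<in> A \<and> y = ?h x" for x y
    using *[of x y] dom[of x y] tot[of x] *[of x] by blast
  show "?h ` A \<subseteq> B"
  proof
    fix y assume "y \<in> ?h ` A"
    then obtain x where "x \<in> A" "y = ?h x" by auto
    moreover from tot[OF \<open>x \<in> A\<close>] obtain z where "E (pr x z) f" by blast
    ultimately show "y \<in> B" using *[of x z] dom[of x z] by simp
  qed
qed

end


section \<open>Metric spaces inside a model\<close>

lemmas term_defs = V_def app_def app2_def tEq_def tAdd_def tMul_def tLe_def tZero_def tOne_def
  tSub_def tDiv_def tAbs_def

abbreviation reals :: ofield where
  "reals \<equiv> \<lparr>carr = 0, zer = Suc 0, uni = 2, addition = 3, multiplication = 4, order = 5\<rparr>"

text \<open>The field lives at the levels 0 to 5, as in the closed formula of the theorem. Its elements are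
  named by a type of class \<open>linordered_field\<close>, which makes the arithmetic of HOL available;
  completeness holds only for subsets that are sets of the model.\<close>

locale real_model = ZF_model E e
  for E :: "'m \<Rightarrow> 'm \<Rightarrow> bool" and e :: "nat \<Rightarrow> 'm" +
  fixes R add mul le :: 'm and rep :: "'r :: linordered_field \<Rightarrow> 'm"
  assumes rep_inject [simp]: "rep x = rep y \<longleftrightarrow> x = y"
    and mem_R: "E c R \<longleftrightarrow> c \<in> range rep"
    and add_rep [simp]: "E (pr (pr (rep x) (rep y)) c) add \<longleftrightarrow> c = rep (x + y)"
    and mul_rep [simp]: "E (pr (pr (rep x) (rep y)) c) mul \<longleftrightarrow> c = rep (x * y)"
    and le_rep [simp]: "E (pr (rep x) (rep y)) le \<longleftrightarrow> x \<le> y"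
    and complete: "\<lbrakk>\<And>x. E x A \<Longrightarrow> E x R; E (rep x) A; \<And>x. E (rep x) A \<Longrightarrow> x \<le> b\<rbrakk>
      \<Longrightarrow> \<exists>s. (\<forall>x. E (rep x) A \<longrightarrow> x \<le> s) \<and> (\<forall>b. (\<forall>x. E (rep x) A \<longrightarrow> x \<le> b) \<longrightarrow> s \<le> b)"
begin

definition base :: "nat \<Rightarrow> (nat \<Rightarrow> 'm) \<Rightarrow> bool" where [simp]:
  "base d v \<longleftrightarrow> 6 \<le> d \<and> v 0 = R \<and> v (Suc 0) = rep 0 \<and> v 2 = rep 1 \<and> v 3 = add \<and> v 4 = mul \<and> v 5 = le"

text \<open>An update at a depth d \<ge> 6 leaves the six levels of the field alone; these facts let
  the simplifier discard it there.\<close>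

lemma depth_simps [simp]:
  "6 \<le> d \<Longrightarrow> (d = 0) = False" "6 \<le> d \<Longrightarrow> (d = Suc 0) = False" "6 \<le> d \<Longrightarrow> (d = 2) = False"
  "6 \<le> d \<Longrightarrow> (d = 3) = False" "6 \<le> d \<Longrightarrow> (d = 4) = False" "6 \<le> d \<Longrightarrow> (d = 5) = False"
  "6 \<le> d \<Longrightarrow> (0 = d) = False" "6 \<le> d \<Longrightarrow> (Suc 0 = d) = False" "6 \<le> d \<Longrightarrow> (2 = d) = False"
  "6 \<le> d \<Longrightarrow> (3 = d) = False" "6 \<le> d \<Longrightarrow> (4 = d) = False" "6 \<le> d \<Longrightarrow> (5 = d) = False"
  by auto

lemma holds_bounded_R [simp]:
  "0 < d \<Longrightarrow> v 0 = R \<Longrightarrow> holds d v (\<^bold>\<forall>x\<^bold>\<in>0. S x) \<longleftrightarrow> (\<forall>r. holds (Suc d) (v(d := rep r)) (S d))"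
  "0 < d \<Longrightarrow> v 0 = R \<Longrightarrow> holds d v (\<^bold>\<exists>x\<^bold>\<in>0. S x) \<longleftrightarrow> (\<exists>r. holds (Suc d) (v(d := rep r)) (S d))"
  by (auto simp: mem_R)

lemma quantifier_R [simp]:
  "(\<forall>a. E a R \<longrightarrow> P a) \<longleftrightarrow> (\<forall>r. P (rep r))"
  "(\<exists>a. E a R \<and> P a) \<longleftrightarrow> (\<exists>r. P (rep r))"
  by (auto simp: mem_R)

section \<open>Metrics, distances to sets and natural numbers\<close>

definition metric :: "'m \<Rightarrow> 'm \<Rightarrow> ('m \<Rightarrow> 'm \<Rightarrow> 'r) \<Rightarrow> bool" where
  "metric S D ds \<longleftrightarrow> (\<forall>x y c. E (pr (pr x y) c) D \<longleftrightarrow> E x S \<and> E y S \<and> c = rep (ds x y)) \<and>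
     (\<forall>x y. E x S \<and> E y S \<longrightarrow> 0 \<le> ds x y \<and> (ds x y = 0 \<longleftrightarrow> x = y) \<and> ds x y = ds y x) \<and>
     (\<forall>x y z. E x S \<and> E y S \<and> E z S \<longrightarrow> ds x z \<le> ds x y + ds y z)"

lemma ex_metric:
  assumes b: "base d v" "S < d" "D < d" and m: "holds d v (is_metric_space reals S D)"
  shows "\<exists>ds. metric (v S) (v D) ds"
proof -
  have "holds d v (is_binary_function D S 0)"
    using m by (simp add: is_metric_space_def)
  moreover have "denotes d v (\<lambda>p. \<^bold>\<exists>x\<^bold>\<in>S. \<^bold>\<exists>y\<^bold>\<in>S. is_pair p x y)
      {p. \<exists>x y. E x (v S) \<and> E y (v S) \<and> p = pr x y}"
    using b by (auto simp: denotes_def)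
  moreover have "denotes d v (elem 0) (range rep)"
    using b by (auto simp: denotes_def mem_R)
  ultimately have "fun_on (v D) {p. \<exists>x y. E x (v S) \<and> E y (v S) \<and> p = pr x y} (range rep)"
    using b by (simp add: is_binary_function_def holds_is_function)
  then obtain h where h: "\<And>x y. E (pr x y) (v D) \<longleftrightarrow> x \<in> {p. \<exists>x y. E x (v S) \<and> E y (v S) \<and> p = pr x y} \<and> y = h x"
    "h ` {p. \<exists>x y. E x (v S) \<and> E y (v S) \<and> p = pr x y} \<subseteq> range rep"
    by (rule fun_onE) blast
  define ds where "ds x y = inv rep (h (pr x y))" for x y
  have rep_ds: "h (pr x y) = rep (ds x y)" if "E x (v S)" "E y (v S)" for x y
    unfolding ds_def using h(2) that by (intro f_inv_into_f[symmetric]) blast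
  have D: "E (pr (pr x y) c) (v D) \<longleftrightarrow> E x (v S) \<and> E y (v S) \<and> c = rep (ds x y)" for x y c
    using rep_ds by (auto simp: h(1))
  have "metric (v S) (v D) ds"
    using m b D unfolding metric_def
    by (simp add: is_metric_space_def term_defs)
  then show ?thesis by (intro exI[of _ ds])
qed


text \<open>A relation, because infima are available only for sets of the model. For empty J every
  element of the field is a lower bound, so no q qualifies: the distance to the empty set is
  infinite.\<close>

definition inf_dist :: "('m \<Rightarrow> 'm \<Rightarrow> 'r) \<Rightarrow> 'm \<Rightarrow> 'm set \<Rightarrow> 'r \<Rightarrow> bool" where
  "inf_dist ds x J q \<longleftrightarrow> (\<forall>y\<in>J. q \<le> ds x y) \<and> (\<forall>q'. (\<forall>y\<in>J. q' \<le> ds x y) \<longrightarrow> q' \<le> q)"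

lemma metric_graph: "metric S D ds \<Longrightarrow> E (pr (pr x y) c) D \<longleftrightarrow> E x S \<and> E y S \<and> c = rep (ds x y)"
  by (simp add: metric_def)

lemma holds_is_set_dist:
  assumes b: "base d v" "S < d" "D < d" "x < d" "r < d" and m: "metric (v S) (v D) ds"
    and J: "denotes d v J X" and X: "\<And>y. y \<in> X \<Longrightarrow> E y (v S)" and x: "E (v x) (v S)"
  shows "holds d v (is_set_dist reals D x J r) \<longleftrightarrow> (\<exists>q. v r = rep q \<and> inf_dist ds (v x) X q)"
proof -
  note [simp] = b(1)[unfolded base_def, THEN conjunct2] metric_graph[OF m] denotesD[OF J] x X
  have "6 \<le> d" using b by simp
  with b(2-) show ?thesis
    by (auto simp: is_set_dist_def inf_dist_def term_defs Ball_def) (auto simp: mem_R)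
qed

lemma holds_in_nbhd:
  assumes b: "base d v" "S < d" "D < d" "x < d" "p < d" and m: "metric (v S) (v D) ds"
    and J: "denotes d v J X" and X: "\<And>y. y \<in> X \<Longrightarrow> E y (v S)" and p: "v p = rep q"
  shows "holds d v (in_nbhd reals S D J p x) \<longleftrightarrow> E (v x) (v S) \<and> (\<exists>r\<le>q. inf_dist ds (v x) X r)"
proof (cases "E (v x) (v S)")
  case True
  have J': "denotes (Suc d) (v(d := a)) J X" for a
    using J by (auto simp: denotes_def)
  have "holds (Suc d) (v(d := a)) (is_set_dist reals D x J d) \<longleftrightarrow> (\<exists>q. a = rep q \<and> inf_dist ds (v x) X q)" for a
    by (subst holds_is_set_dist[OF _ _ _ _ _ _ J', where S = S and ds = ds]) (use b m X True in simp_all)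
  with True b p show ?thesis
    by (simp add: in_nbhd_def tLe_def V_def) (metis le_rep)
qed (use b in \<open>simp add: in_nbhd_def\<close>)

text \<open>Induction is tested only on sets I of the model, so these are the natural numbers in the
  sense of the model, possibly with nonstandard elements.\<close>

definition natural :: "'r \<Rightarrow> bool" where
  "natural r \<longleftrightarrow> (\<forall>I. (\<forall>x. E x I \<longrightarrow> E x R) \<and> E (rep 0) I \<and> (\<forall>x. E (rep x) I \<longrightarrow> E (rep (x + 1)) I)
     \<longrightarrow> E (rep r) I)"

lemma holds_is_natural:
  assumes "base d v" "n < d"
  shows "holds d v (is_natural reals n) \<longleftrightarrow> (\<exists>r. v n = rep r \<and> natural r)"
proof -
  have *: "(\<forall>x. E x I \<longrightarrow> (\<exists>y. E y I \<and> (\<exists>c. E (pr (pr x (rep 1)) c) add \<and> y = c))) \<longleftrightarrow>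
     (\<forall>x. E (rep x) I \<longrightarrow> E (rep (x + 1)) I)" if "\<forall>x. E x I \<longrightarrow> E x R" for I
  proof -
    have "\<exists>r. x = rep r" if "E x I" for x
      using \<open>\<forall>x. E x I \<longrightarrow> E x R\<close> that by (auto simp: mem_R)
    then show ?thesis by (auto; metis add_rep)
  qed
  have "holds d v (is_natural reals n) \<longleftrightarrow> E (v n) R \<and> (\<forall>I. (\<forall>x. E x I \<longrightarrow> E x R) \<and> E (rep 0) I \<and>
    (\<forall>x. E x I \<longrightarrow> (\<exists>y. E y I \<and> (\<exists>c. E (pr (pr x (rep 1)) c) add \<and> y = c))) \<longrightarrow> E (v n) I)"
    using assms by (simp add: is_natural_def term_defs)
  also have "\<dots> \<longleftrightarrow> E (v n) R \<and> (\<forall>I. (\<forall>x. E x I \<longrightarrow> E x R) \<and> E (rep 0) I \<and>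
    (\<forall>x. E (rep x) I \<longrightarrow> E (rep (x + 1)) I) \<longrightarrow> E (v n) I)"
    using * by blast
  finally show ?thesis by (auto simp: natural_def mem_R)
qed

section \<open>Geodesics and trees\<close>

definition geodesic :: "'m \<Rightarrow> ('m \<Rightarrow> 'm \<Rightarrow> 'r) \<Rightarrow> 'm \<Rightarrow> 'm \<Rightarrow> 'm \<Rightarrow> bool" where
  "geodesic S ds x y \<rho> \<longleftrightarrow> fun_on \<rho> (rep ` {0..ds x y}) {w. E w S} \<and>
     (\<forall>s t. 0 \<le> s \<and> s \<le> ds x y \<and> 0 \<le> t \<and> t \<le> ds x y \<longrightarrow>
       (\<exists>u w. E (pr (rep s) u) \<rho> \<and> E (pr (rep t) w) \<rho> \<and> E u S \<and> E w S \<and> ds u w = \<bar>s - t\<bar>)) \<and>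
     E (pr (rep 0) x) \<rho> \<and> E (pr (rep (ds x y)) y) \<rho>"

lemma holds_is_geodesic:
  assumes b: "base d v" "S < d" "D < d" "x < d" "y < d" "\<rho> < d" and m: "metric (v S) (v D) ds"
    and x: "E (v x) (v S)" "E (v y) (v S)"
  shows "holds d v (is_geodesic reals S D x y \<rho>) \<longleftrightarrow> geodesic (v S) ds (v x) (v y) (v \<rho>)"
proof -
  note [simp] = b(1)[unfolded base_def, THEN conjunct2] metric_graph[OF m] x
  have int: "holds d' w (in_interval reals l z) \<longleftrightarrow> (\<exists>s. w z = rep s \<and> 0 \<le> s \<and> s \<le> r)"
    if "base d' w" "l < d'" "z < d'" "w l = rep r" for d' w l z r
  proof -
    from that have "holds d' w (in_interval reals l z) \<longleftrightarrow>
      w z \<in> range rep \<and> E (pr (rep 0) (w z)) le \<and> E (pr (w z) (rep r)) le"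
      by (simp add: in_interval_def term_defs mem_R)
    then show ?thesis by auto
  qed
  \<comment> \<open>Unfolded, \<open>tAbs\<close> describes differences by the equations they solve;
    this equivalence recognises the absolute value in that form.\<close>
  have abs: "((\<exists>r. s = t + r \<and> 0 \<le> r) \<longrightarrow> s = t + q) \<and>
      ((\<forall>r. s = t + r \<longrightarrow> \<not> 0 \<le> r) \<longrightarrow> (\<exists>r. s = t + r \<and> r + q = 0)) \<longleftrightarrow> q = \<bar>s - t\<bar>"
    for q s t :: 'r
  proof -
    have "s = t + r \<longleftrightarrow> r = s - t" for r by auto
    then show ?thesis by (auto simp: abs_if)
  qed
  have A: "denotes (Suc d) (v(d := rep r)) (in_interval reals d) (rep ` {0..r})" for r
  proof -
    have "holds d' w (in_interval reals d z) \<longleftrightarrow> w z \<in> rep ` {0..r}"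
      if "Suc d \<le> d'" "\<forall>i<Suc d. w i = (v(d := rep r)) i" "z < d'" for d' w z
    proof -
      have "w i = v i" if "i < d" for i
        using that \<open>\<forall>i<Suc d. _ i\<close> by simp
      with b(1) that(1) have "base d' w" by simp
      moreover have "w d = rep r" using that(2) by simp
      ultimately show ?thesis using int[of d' w d z r] that by auto
    qed
    then show ?thesis unfolding denotes_def by blast
  qed
  have B: "denotes (Suc d) (v(d := rep r)) (elem S) {w. E w (v S)}" for r
    unfolding denotes_def using b by auto
  have R: "(\<forall>s t. (\<exists>r. s = rep r \<and> 0 \<le> r \<and> r \<le> l) \<and> (\<exists>r. t = rep r \<and> 0 \<le> r \<and> r \<le> l) \<longrightarrow> P s t) \<longleftrightarrow>
    (\<forall>s t. 0 \<le> s \<and> s \<le> l \<and> 0 \<le> t \<and> t \<le> l \<longrightarrow> P (rep s) (rep t))" for l P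
    by auto
  have "6 \<le> d" using b by simp
  have F: "holds (Suc d) (v(d := rep r)) (is_function \<rho> (in_interval reals d) (elem S)) \<longleftrightarrow>
      fun_on (v \<rho>) (rep ` {0..r}) {w. E w (v S)}" for r
    by (subst holds_is_function[OF _ A B]) (use b(6) in auto)
  from \<open>6 \<le> d\<close> b(2-) show ?thesis
    by (simp add: is_geodesic_def F term_defs int R abs geodesic_def)
qed

text \<open>Lying in the 0-neighbourhood of two sides means that the infimum of the distances is at
  most 0. Whether some point attains it is left open, so later arguments work with points closer
  than a positive \<epsilon>.\<close>

definition tree :: "'m \<Rightarrow> ('m \<Rightarrow> 'm \<Rightarrow> 'r) \<Rightarrow> bool" where
  "tree S ds \<longleftrightarrow> (\<forall>x y. E x S \<and> E y S \<longrightarrow> (\<exists>\<rho>. geodesic S ds x y \<rho>)) \<and>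
     (\<forall>x y z \<rho> \<sigma> \<tau> w. E x S \<and> E y S \<and> E z S \<and>
        geodesic S ds x y \<rho> \<and> geodesic S ds x z \<sigma> \<and> geodesic S ds y z \<tau> \<and> (\<exists>s. E (pr s w) \<rho>) \<longrightarrow>
        (\<exists>q\<le>0. inf_dist ds w {u. (\<exists>s. E (pr s u) \<sigma>) \<or> (\<exists>s. E (pr s u) \<tau>)} q))"

lemma geodesic_range: "geodesic S ds x y \<rho> \<Longrightarrow> E (pr s w) \<rho> \<Longrightarrow> E w S"
  unfolding geodesic_def fun_on_def by fastforce

lemma holds_is_real_tree:
  assumes b: "base d v" "S < d" "D < d" and t: "holds d v (is_real_tree reals S D)"
  shows "\<exists>ds. metric (v S) (v D) ds \<and> tree (v S) ds"
proof -
  have "holds d v (is_metric_space reals S D)"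
    using t by (simp add: is_real_tree_def is_hyperbolic_def is_geodesic_space_def)
  then obtain ds where m: "metric (v S) (v D) ds"
    using ex_metric[OF b] by blast
  have g: "holds d' w (is_geodesic reals S D x y \<rho>) \<longleftrightarrow> geodesic (v S) ds (w x) (w y) (w \<rho>)"
    if "d \<le> d'" "x < d'" "y < d'" "\<rho> < d'" "\<And>i. i < d \<Longrightarrow> w i = v i" "E (w x) (v S)" "E (w y) (v S)"
    for d' w x y \<rho>
    using b m that holds_is_geodesic[of d' w S D x y \<rho> ds] by simp
  have "\<exists>\<rho>. geodesic (v S) ds x y \<rho>" if "E x (v S)" "E y (v S)" for x y
    using t b that by (simp add: is_real_tree_def is_hyperbolic_def is_geodesic_space_def g)
  moreover have "\<exists>q\<le>0. inf_dist ds w {u. (\<exists>s. E (pr s u) \<sigma>) \<or> (\<exists>s. E (pr s u) \<tau>)} q"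
    if A: "E x (v S)" "E y (v S)" "E z (v S)" "geodesic (v S) ds x y \<rho>"
      "geodesic (v S) ds x z \<sigma>" "geodesic (v S) ds y z \<tau>" "\<exists>s. E (pr s w) \<rho>" for x y z \<rho> \<sigma> \<tau> w
  proof -
    let ?v = "v(d := x, Suc d := y, Suc (Suc d) := z, Suc (Suc (Suc d)) := \<rho>,
      Suc (Suc (Suc (Suc d))) := \<sigma>, Suc (Suc (Suc (Suc (Suc d)))) := \<tau>,
      Suc (Suc (Suc (Suc (Suc (Suc d))))) := w)"
    let ?J = "\<lambda>u. in_range (Suc (Suc (Suc (Suc d)))) u \<^bold>\<or> in_range (Suc (Suc (Suc (Suc (Suc d))))) u"
    let ?d = "Suc (Suc (Suc (Suc (Suc (Suc (Suc d))))))"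
    let ?X = "{u. (\<exists>s. E (pr s u) \<sigma>) \<or> (\<exists>s. E (pr s u) \<tau>)}"
    \<comment> \<open>Level \<open>Suc 0\<close> holds the zero of the field, which is the \<delta>
      of a real tree.\<close>
    have "holds ?d ?v (in_nbhd reals S D ?J (Suc 0) (Suc (Suc (Suc (Suc (Suc (Suc d)))))))"
      using t b by (simp add: is_real_tree_def is_hyperbolic_def g) (use A in blast)
    moreover have den: "denotes ?d ?v ?J ?X"
      unfolding denotes_def by auto
    moreover have "holds ?d ?v (in_nbhd reals S D ?J (Suc 0) (Suc (Suc (Suc (Suc (Suc (Suc d))))))) \<longleftrightarrow>
        E (?v (Suc (Suc (Suc (Suc (Suc (Suc d))))))) (?v S) \<and>
        (\<exists>q\<le>0. inf_dist ds (?v (Suc (Suc (Suc (Suc (Suc (Suc d))))))) ?X q)"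
      by (rule holds_in_nbhd)
        (use b m geodesic_range[OF A(5)] geodesic_range[OF A(6)] den in auto)
    ultimately show ?thesis using b by simp
  qed
  ultimately show ?thesis
    using m unfolding tree_def by blast
qed

section \<open>Quasi-isometries\<close>

definition quasi_isometry :: "'m \<Rightarrow> ('m \<Rightarrow> 'm \<Rightarrow> 'r) \<Rightarrow> 'm \<Rightarrow> ('m \<Rightarrow> 'm \<Rightarrow> 'r) \<Rightarrow> 'm \<Rightarrow> bool" where
  "quasi_isometry S ds T dt f \<longleftrightarrow> fun_on f {x. E x S} {y. E y T} \<and>
     (\<exists>n\<ge>1. natural n \<and> (\<forall>y. E y T \<longrightarrow> (\<exists>q\<le>n. inf_dist dt y {y. \<exists>x. E (pr x y) f} q)) \<and>
       (\<forall>x y u w. E (pr x u) f \<and> E (pr y w) f \<longrightarrow>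
         ds x y / n - n \<le> dt u w \<and> dt u w \<le> n * ds x y + n))"

lemma holds_is_quasi_isometry:
  assumes b: "base d v" "S < d" "D < d" "T < d" "D' < d" "f < d"
    and m: "metric (v S) (v D) ds" "metric (v T) (v D') dt"
  shows "holds d v (is_quasi_isometry reals S D T D' f) \<longleftrightarrow> quasi_isometry (v S) ds (v T) dt (v f)"
proof (cases "fun_on (v f) {x. E x (v S)} {y. E y (v T)}")
  case False
  have "holds d v (is_function f (elem S) (elem T)) \<longleftrightarrow> fun_on (v f) {x. E x (v S)} {y. E y (v T)}"
    by (rule holds_is_function) (use b in \<open>auto simp: denotes_def\<close>)
  with False show ?thesis by (simp add: is_quasi_isometry_def quasi_isometry_def)
next
  case True
  note [simp] = b(1)[unfolded base_def, THEN conjunct2] metric_graph[OF m(1)] metric_graph[OF m(2)]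
  have d: "6 \<le> d" using b by simp
  have F: "holds d v (is_function f (elem S) (elem T))"
    by (subst holds_is_function) (use b True in \<open>auto simp: denotes_def\<close>)
  obtain h where h': "\<And>x y. E (pr x y) (v f) \<longleftrightarrow> x \<in> {x. E x (v S)} \<and> y = h x"
    and hT': "h ` {x. E x (v S)} \<subseteq> {y. E y (v T)}"
    using True by (rule fun_onE) blast
  then have h [simp]: "E (pr x y) (v f) \<longleftrightarrow> E x (v S) \<and> y = h x"
    and hT: "E x (v S) \<Longrightarrow> E (h x) (v T)" for x y
    by auto
  have body: "holds (Suc d) (v(d := rep n)) (\<^bold>\<forall>x\<^bold>\<in>S. \<^bold>\<forall>y\<^bold>\<in>S.
            ((\<one>\<^bsub>reals\<^esub> \<oslash>\<^bsub>reals\<^esub> V d) \<otimes>\<^bsub>reals\<^esub> app2 D (V x) (V y) \<ominus>\<^bsub>reals\<^esub> V d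
               \<preceq>\<^bsub>reals\<^esub> app2 D' (app f (V x)) (app f (V y))) \<^bold>\<and>
            (app2 D' (app f (V x)) (app f (V y))
               \<preceq>\<^bsub>reals\<^esub> V d \<otimes>\<^bsub>reals\<^esub> app2 D (V x) (V y) \<oplus>\<^bsub>reals\<^esub> V d)) \<longleftrightarrow>
       (\<forall>x y. E x (v S) \<and> E y (v S) \<longrightarrow>
         ds x y / n - n \<le> dt (h x) (h y) \<and> dt (h x) (h y) \<le> n * ds x y + n)" if "1 \<le> n" for n
  proof -
    have "n \<noteq> 0" using that by auto
    \<comment> \<open>Quotients and differences in the formula are solutions of equations; the
      quotient is well defined because n \<noteq> 0.\<close>
    then have "n * c = 1 \<longleftrightarrow> c = 1 / n" for c by (auto simp: field_simps)
    moreover have "c = n + r \<longleftrightarrow> r = c - n" for r c by auto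
    ultimately show ?thesis
      using d b(2-) hT by (simp add: term_defs) blast
  qed
  have nbhd: "holds (Suc (Suc d)) (v(d := rep n, Suc d := y)) (in_nbhd reals T D' (in_range f) d (Suc d)) \<longleftrightarrow>
      E y (v T) \<and> (\<exists>q\<le>n. inf_dist dt y {y. \<exists>x. E (pr x y) (v f)} q)" for n y
  proof -
    let ?v = "v(d := rep n, Suc d := y)"
    have "denotes (Suc (Suc d)) ?v (in_range f) {y. \<exists>x. E (pr x y) (v f)}"
      unfolding denotes_def using b by (auto simp del: h)
    then have "holds (Suc (Suc d)) ?v (in_nbhd reals T D' (in_range f) d (Suc d)) \<longleftrightarrow>
      E (?v (Suc d)) (?v T) \<and> (\<exists>q\<le>n. inf_dist dt (?v (Suc d)) {y. \<exists>x. E (pr x y) (v f)} q)"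
      by (intro holds_in_nbhd) (use b m hT in auto)
    then show ?thesis using b by simp
  qed
  have nat: "holds (Suc d) (v(d := a)) (is_natural reals d) \<longleftrightarrow> (\<exists>r. a = rep r \<and> natural r)" for a
    using holds_is_natural[of "Suc d" "v(d := a)" d] b by simp
  have "holds d v (is_quasi_isometry reals S D T D' f) \<longleftrightarrow>
    (\<exists>n\<ge>1. natural n \<and> (\<forall>y. E y (v T) \<longrightarrow> (\<exists>q\<le>n. inf_dist dt y {y. \<exists>x. E (pr x y) (v f)} q)) \<and>
      (\<forall>x y. E x (v S) \<and> E y (v S) \<longrightarrow>
         ds x y / n - n \<le> dt (h x) (h y) \<and> dt (h x) (h y) \<le> n * ds x y + n))"
    (is "_ \<longleftrightarrow> (\<exists>n\<ge>1. natural n \<and> ?P n \<and> ?Q n)")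
  proof -
    let ?body = "\<^bold>\<forall>x\<^bold>\<in>S. \<^bold>\<forall>y\<^bold>\<in>S.
            ((\<one>\<^bsub>reals\<^esub> \<oslash>\<^bsub>reals\<^esub> V d) \<otimes>\<^bsub>reals\<^esub> app2 D (V x) (V y) \<ominus>\<^bsub>reals\<^esub> V d
               \<preceq>\<^bsub>reals\<^esub> app2 D' (app f (V x)) (app f (V y))) \<^bold>\<and>
            (app2 D' (app f (V x)) (app f (V y))
               \<preceq>\<^bsub>reals\<^esub> V d \<otimes>\<^bsub>reals\<^esub> app2 D (V x) (V y) \<oplus>\<^bsub>reals\<^esub> V d)"
    have le: "holds (Suc d) (v(d := rep n)) (\<one>\<^bsub>reals\<^esub> \<preceq>\<^bsub>reals\<^esub> V d) \<longleftrightarrow> 1 \<le> n" for n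
      using d by (simp add: tLe_def tOne_def V_def)
    have surj: "holds (Suc d) (v(d := rep n)) (\<^bold>\<forall>y. in_nbhd reals T D' (in_range f) d y \<^bold>\<longleftrightarrow> y \<^bold>\<in> T) \<longleftrightarrow> ?P n" for n
      using d b(2-) by (simp add: nbhd) blast
    have gen: "(\<exists>a. (\<exists>r. a = rep r \<and> natural r) \<and> holds (Suc d) (v(d := a)) (\<one>\<^bsub>reals\<^esub> \<preceq>\<^bsub>reals\<^esub> V d) \<and>
        holds (Suc d) (v(d := a)) (\<^bold>\<forall>y. in_nbhd reals T D' (in_range f) d y \<^bold>\<longleftrightarrow> y \<^bold>\<in> T) \<and>
        holds (Suc d) (v(d := a)) Q) \<longleftrightarrow> (\<exists>n. natural n \<and> 1 \<le> n \<and> ?P n \<and> holds (Suc d) (v(d := rep n)) Q)" for Q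
      using le surj by blast
    have "holds d v (is_quasi_isometry reals S D T D' f) \<longleftrightarrow>
      (\<exists>a. (\<exists>r. a = rep r \<and> natural r) \<and> holds (Suc d) (v(d := a)) (\<one>\<^bsub>reals\<^esub> \<preceq>\<^bsub>reals\<^esub> V d) \<and>
        holds (Suc d) (v(d := a)) (\<^bold>\<forall>y. in_nbhd reals T D' (in_range f) d y \<^bold>\<longleftrightarrow> y \<^bold>\<in> T) \<and>
        holds (Suc d) (v(d := a)) ?body)"
      unfolding is_quasi_isometry_def holds_connectives nat using F by simp
    also have "\<dots> \<longleftrightarrow> (\<exists>n. natural n \<and> 1 \<le> n \<and> ?P n \<and>
        holds (Suc d) (v(d := rep n)) ?body)"
      by (rule gen)
    finally show ?thesis using body by blast
  qed
  then show ?thesis unfolding quasi_isometry_def using True by (auto simp: hT)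
qed


section \<open>The quasi-inverse\<close>

text \<open>Parameters for Separation: the field at the levels 0 to 5, then xs from level 6 on. The
  element under test comes right after xs, so its level is 6 plus the length of xs.\<close>

definition assign :: "'m list \<Rightarrow> nat \<Rightarrow> 'm" where
  "assign xs i = ([R, rep 0, rep 1, add, mul, le] @ xs) ! i"

lemma base_assign [simp]: "6 \<le> d \<Longrightarrow> base d (assign xs)"
  by (simp add: assign_def)

section \<open>Archimedean property and existence of infima\<close>

lemma natural_0: "natural 0"
  by (simp add: natural_def)

lemma natural_add_1: "natural r \<Longrightarrow> natural (r + 1)"
  unfolding natural_def by blast

text \<open>The naturals are definable and thus form a set of the model, to which completeness
  applies. Were they bounded, closure under adding 1 would make s - 1 an upper bound below their
  supremum s.\<close>

lemma archimedean: "\<exists>n. natural n \<and> r \<le> n"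
proof (rule ccontr)
  assume "\<not> (\<exists>n. natural n \<and> r \<le> n)"
  then have r: "n \<le> r" if "natural n" for n
    using that by (meson le_cases)
  obtain A where "\<And>x. E x A \<longleftrightarrow> E x R \<and> holds 7 ((assign [])(6 := x)) (is_natural reals 6)"
    using separation[of R 6 "assign []" "is_natural reals 6"] by auto
  moreover have "holds 7 ((assign [])(6 := x)) (is_natural reals 6) \<longleftrightarrow> (\<exists>r. x = rep r \<and> natural r)" for x
    by (subst holds_is_natural) (simp_all add: assign_def)
  ultimately have A: "E x A \<longleftrightarrow> (\<exists>r. x = rep r \<and> natural r)" for x
    by (auto simp: mem_R)
  obtain s where s: "\<And>x. natural x \<Longrightarrow> x \<le> s" "\<And>b. (\<And>x. natural x \<Longrightarrow> x \<le> b) \<Longrightarrow> s \<le> b"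
    using complete[of A 0 r] r natural_0 by (auto simp: A mem_R)
  have "x \<le> s - 1" if "natural x" for x
    using s(1)[OF natural_add_1[OF that]] by simp
  from s(2)[OF this] show False by simp
qed

text \<open>The infimum is the supremum of the set L of lower bounds, which Separation cuts out of R
  with the set J of the model as a parameter. L contains 0 and is bounded by the distance to
  y0.\<close>

lemma inf_dist_exists:
  assumes m: "metric S D ds" and x: "E x S" and J: "\<And>y. E y J \<Longrightarrow> E y S" "E y0 J"
  shows "\<exists>q. inf_dist ds x {y. E y J} q"
proof -
  note [simp] = metric_graph[OF m]
  let ?P = "\<^bold>\<forall>y\<^bold>\<in>8. V 9 \<preceq>\<^bsub>reals\<^esub> app2 6 (V 7) (V y)"
  obtain L where "\<And>c. E c L \<longleftrightarrow> E c R \<and> holds 10 ((assign [D, x, J])(9 := c)) ?P"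
    using separation[of R 9 "assign [D, x, J]" ?P] by auto
  moreover have "holds 10 ((assign [D, x, J])(9 := rep r)) ?P \<longleftrightarrow> (\<forall>y. E y J \<longrightarrow> r \<le> ds x y)" for r
    using x J(1) by (auto simp: term_defs assign_def)
  ultimately have L: "E c L \<longleftrightarrow> (\<exists>r. c = rep r \<and> (\<forall>y. E y J \<longrightarrow> r \<le> ds x y))" for c
    by (auto simp: mem_R)
  have "\<forall>y. E y J \<longrightarrow> 0 \<le> ds x y"
    using m x J(1) by (simp add: metric_def)
  then obtain s where "\<forall>r. (\<forall>y. E y J \<longrightarrow> r \<le> ds x y) \<longrightarrow> r \<le> s"
    and "\<And>b. (\<forall>r. (\<forall>y. E y J \<longrightarrow> r \<le> ds x y) \<longrightarrow> r \<le> b) \<Longrightarrow> s \<le> b"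
    using complete[of L 0 "ds x y0"] J(2) by (auto simp: L mem_R)
  then have "inf_dist ds x {y. E y J} s"
    unfolding inf_dist_def by auto
  then show ?thesis ..
qed

lemma geodesicE:
  assumes "geodesic S ds x y \<rho>"
  obtains h where "\<And>c u. E (pr c u) \<rho> \<longleftrightarrow> (\<exists>s. c = rep s \<and> 0 \<le> s \<and> s \<le> ds x y \<and> u = h s)"
    and "\<And>s. 0 \<le> s \<Longrightarrow> s \<le> ds x y \<Longrightarrow> E (h s) S"
    and "\<And>s t. 0 \<le> s \<Longrightarrow> s \<le> ds x y \<Longrightarrow> 0 \<le> t \<Longrightarrow> t \<le> ds x y \<Longrightarrow> ds (h s) (h t) = \<bar>s - t\<bar>"
    and "h 0 = x" and "h (ds x y) = y"
proof -
  have g: "fun_on \<rho> (rep ` {0..ds x y}) {w. E w S}"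
    "\<And>s t. 0 \<le> s \<Longrightarrow> s \<le> ds x y \<Longrightarrow> 0 \<le> t \<Longrightarrow> t \<le> ds x y \<Longrightarrow>
       (\<exists>u w. E (pr (rep s) u) \<rho> \<and> E (pr (rep t) w) \<rho> \<and> E u S \<and> E w S \<and> ds u w = \<bar>s - t\<bar>)"
    "E (pr (rep 0) x) \<rho>" "E (pr (rep (ds x y)) y) \<rho>"
    using assms unfolding geodesic_def by auto
  from g(1) obtain h where h: "\<And>c u. E (pr c u) \<rho> \<longleftrightarrow> c \<in> rep ` {0..ds x y} \<and> u = h c"
    and hS: "h ` rep ` {0..ds x y} \<subseteq> {w. E w S}"
    by (rule fun_onE) blast
  show thesis
  proof (rule that[of "\<lambda>s. h (rep s)"])
    show "E (pr c u) \<rho> \<longleftrightarrow> (\<exists>s. c = rep s \<and> 0 \<le> s \<and> s \<le> ds x y \<and> u = h (rep s))" for c u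
      using h by auto
    show "ds (h (rep s)) (h (rep t)) = \<bar>s - t\<bar>"
      if "0 \<le> s" "s \<le> ds x y" "0 \<le> t" "t \<le> ds x y" for s t
      using g(2)[OF that] by (auto simp: h)
    show "h (rep 0) = x" "h (rep (ds x y)) = y"
      using g(3,4) by (auto simp: h)
    show "E (h (rep s)) S" if "0 \<le> s" "s \<le> ds x y" for s
      using hS that by (auto simp: image_subset_iff)
  qed
qed

section \<open>Common initial parts of geodesics in a tree\<close>

lemma metricD:
  assumes "metric S D ds" "E x S" "E y S"
  shows "0 \<le> ds x y" and "ds x y = 0 \<longleftrightarrow> x = y" and "ds x y = ds y x"
    and "E z S \<Longrightarrow> ds x z \<le> ds x y + ds y z"
  using assms by (simp_all add: metric_def)

lemma inf_dist_approx: "inf_dist ds w X q \<Longrightarrow> q < r \<Longrightarrow> \<exists>u\<in>X. ds w u < r"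
  unfolding inf_dist_def by (meson leD leI)

text \<open>Up to the Gromov product of a and b, the geodesics from p to a and b agree: the geodesic from a
  to b stays farther away from p, so hyperbolicity leaves only points of the other geodesic.\<close>

lemma geodesics_agree:
  assumes m: "metric S D ds" and t: "tree S ds" and S: "E p S" "E a S" "E b S"
    and g: "geodesic S ds p a \<rho>" "geodesic S ds p b \<sigma>"
    and s: "2 * s < ds p a + ds p b - ds a b"
    and u: "E (pr (rep s) u) \<rho>" and w: "E (pr (rep s) w) \<sigma>"
  shows "u = w"
proof (rule ccontr)
  assume "u \<noteq> w"
  from g(1) obtain h where h: "\<And>c u. E (pr c u) \<rho> \<longleftrightarrow> (\<exists>s. c = rep s \<and> 0 \<le> s \<and> s \<le> ds p a \<and> u = h s)"
    "\<And>s. 0 \<le> s \<Longrightarrow> s \<le> ds p a \<Longrightarrow> E (h s) S"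
    "\<And>s t. 0 \<le> s \<Longrightarrow> s \<le> ds p a \<Longrightarrow> 0 \<le> t \<Longrightarrow> t \<le> ds p a \<Longrightarrow> ds (h s) (h t) = \<bar>s - t\<bar>"
    "h 0 = p" "h (ds p a) = a"
    by (rule geodesicE) blast
  from g(2) obtain k where k: "\<And>c u. E (pr c u) \<sigma> \<longleftrightarrow> (\<exists>s. c = rep s \<and> 0 \<le> s \<and> s \<le> ds p b \<and> u = k s)"
    "\<And>s. 0 \<le> s \<Longrightarrow> s \<le> ds p b \<Longrightarrow> E (k s) S"
    "\<And>s t. 0 \<le> s \<Longrightarrow> s \<le> ds p b \<Longrightarrow> 0 \<le> t \<Longrightarrow> t \<le> ds p b \<Longrightarrow> ds (k s) (k t) = \<bar>s - t\<bar>"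
    "k 0 = p" "k (ds p b) = b"
    by (rule geodesicE) blast
  obtain \<tau> where \<tau>: "geodesic S ds a b \<tau>"
    using t S unfolding tree_def by blast
  then obtain l where l: "\<And>c u. E (pr c u) \<tau> \<longleftrightarrow> (\<exists>s. c = rep s \<and> 0 \<le> s \<and> s \<le> ds a b \<and> u = l s)"
    "\<And>s. 0 \<le> s \<Longrightarrow> s \<le> ds a b \<Longrightarrow> E (l s) S"
    "\<And>s t. 0 \<le> s \<Longrightarrow> s \<le> ds a b \<Longrightarrow> 0 \<le> t \<Longrightarrow> t \<le> ds a b \<Longrightarrow> ds (l s) (l t) = \<bar>s - t\<bar>"
    "l 0 = a" "l (ds a b) = b"
    by (rule geodesicE) blast
  have s': "0 \<le> s" "s \<le> ds p a" "s \<le> ds p b" and uw: "u = h s" "w = k s"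
    using u w h(1) k(1) by auto
  have uS: "E u S" and wS: "E w S" using s' uw h(2) k(2) by auto
  have pa: "0 \<le> ds p a" and pb: "0 \<le> ds p b" and ab: "0 \<le> ds a b" using metricD(1)[OF m] S by auto
  have pu: "ds p u = s" using h(3)[of 0 s] s' pa h(4) uw by simp
  define \<delta> where "\<delta> = ds u w"
  have \<delta>: "0 < \<delta>"
    using metricD(1,2)[OF m uS wS] \<open>u \<noteq> w\<close> unfolding \<delta>_def by simp
  \<comment> \<open>Some z on the other two sides is closer to u than \<epsilon>. If z lies on
    \<open>\<sigma>\<close> at parameter r, then |r - s| < \<epsilon>, so u and w are closer than
    2\<epsilon> \<le> \<delta>; the other bound on \<epsilon> excludes z on
    \<open>\<tau>\<close>.\<close>
  define \<epsilon> where "\<epsilon> = min \<delta> (ds p a + ds p b - ds a b - 2 * s) / 2"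
  have \<epsilon>: "0 < \<epsilon>" "2 * \<epsilon> \<le> \<delta>" "2 * \<epsilon> \<le> ds p a + ds p b - ds a b - 2 * s"
    using \<delta> s unfolding \<epsilon>_def by simp_all
  obtain q where q: "q \<le> 0" "inf_dist ds u {u. (\<exists>s. E (pr s u) \<sigma>) \<or> (\<exists>s. E (pr s u) \<tau>)} q"
    using t S g \<tau> u unfolding tree_def by blast
  then obtain z where z: "(\<exists>s. E (pr s z) \<sigma>) \<or> (\<exists>s. E (pr s z) \<tau>)" "ds u z < \<epsilon>"
    using inf_dist_approx[OF q(2), of \<epsilon>] q(1) \<epsilon>(1) by auto
  from z(1) show False
  proof (elim disjE exE)
    fix c assume "E (pr c z) \<sigma>"
    then obtain r where r: "0 \<le> r" "r \<le> ds p b" "z = k r" using k(1) by auto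
    have zS: "E z S" using r k(2) by simp
    have pz: "ds p z = r" using k(3)[of 0 r] r pb k(4) by simp
    have zw: "ds z w = \<bar>r - s\<bar>" using k(3)[of r s] r s' uw by simp
    have "ds p z \<le> ds p u + ds u z" "ds p u \<le> ds p z + ds z u" "ds z u = ds u z"
      "ds u w \<le> ds u z + ds z w"
      by (rule metricD(4)[OF m] metricD(3)[OF m]; use S uS wS zS in simp)+
    then show False using pz zw pu z(2) \<epsilon> unfolding \<delta>_def by (simp add: abs_if split: if_splits)
  next
    \<comment> \<open>As z splits the distance from a to b, adding the triangle inequalities for a
      and b bounds d(p,z) below by the Gromov product, which is at least s + \<epsilon>; but u is at
      distance s from p and closer than \<epsilon> to z.\<close>
    fix c assume "E (pr c z) \<tau>"
    then obtain r where r: "0 \<le> r" "r \<le> ds a b" "z = l r" using l(1) by auto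
    have zS: "E z S" using r l(2) by simp
    have az: "ds a z = r" using l(3)[of 0 r] r ab l(4) by simp
    have zb: "ds z b = ds a b - r" using l(3)[of r "ds a b"] r ab l(5) by simp
    have "ds p z \<le> ds p u + ds u z" "ds p a \<le> ds p z + ds z a" "ds p b \<le> ds p z + ds z b" "ds z a = ds a z"
      by (rule metricD(4)[OF m] metricD(3)[OF m]; use S uS zS in simp)+
    then show False using az zb pu z(2) \<epsilon> by simp
  qed
qed


lemma inf_dist_unique: "inf_dist ds x X q \<Longrightarrow> inf_dist ds x X q' \<Longrightarrow> q = q'"
  unfolding inf_dist_def by (meson order.antisym)

text \<open>If S has no points, there is no base point. The range of f is then empty, so no point of
  T can be within n of it and T is empty too; the empty relation f serves in both
  directions.\<close>

lemma quasi_isometry_from_empty: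
  assumes q: "quasi_isometry S ds T dt f" and S: "\<not> (\<exists>x. E x S)"
  shows "\<exists>g. quasi_isometry T dt S ds g"
proof -
  have f: "fun_on f {x. E x S} {y. E y T}"
    using q by (simp add: quasi_isometry_def)
  have f0: "\<not> E p f" for p
    using f S unfolding fun_on_def by blast
  obtain n where n: "n \<ge> 1" "natural n" "\<And>y. E y T \<Longrightarrow> \<exists>q\<le>n. inf_dist dt y {} q"
    using q f0 unfolding quasi_isometry_def by auto
  \<comment> \<open>Every number bounds the empty set from below, so \<open>q + 1\<close> refutes q
    as greatest lower bound.\<close>
  have "\<not> inf_dist dt y {} q" for y q
    unfolding inf_dist_def by (auto intro: exI[of _ "q + 1"])
  with n(3) have "\<not> E y T" for y by blast
  with S f0 n(1,2) have "quasi_isometry T dt S ds f"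
    unfolding quasi_isometry_def fun_on_def by auto
  then show ?thesis ..
qed

text \<open>The constant c is to exceed the diameter of A; for A within distance c of p, the chosen point is p
  itself.\<close>

definition section_of :: "'m \<Rightarrow> ('m \<Rightarrow> 'm \<Rightarrow> 'r) \<Rightarrow> 'm set \<Rightarrow> 'm \<Rightarrow> 'r \<Rightarrow> 'm \<Rightarrow> bool" where
  "section_of S ds A p c q \<longleftrightarrow> (\<exists>m. inf_dist ds p A m \<and>
     (\<exists>a\<in>A. \<exists>\<rho>. geodesic S ds p a \<rho> \<and> E (pr (rep (max 0 (m - c))) q) \<rho>))"

text \<open>Distances from p to J lie between the infimum i and i + k. The geodesics to J agree at
  parameter s = max 0 (i - (k + 1)), and the remaining length to a is at most i + k - s \<le> 2k +
  1.\<close>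

lemma section_of_unique_close:
  assumes m: "metric S D ds" and t: "tree S ds" and p: "E p S" and J: "\<And>y. E y J \<Longrightarrow> E y S" "E y0 J"
    and diam: "\<And>a b. E a J \<Longrightarrow> E b J \<Longrightarrow> ds a b \<le> k" and k: "0 \<le> k"
  shows "\<exists>q. E q S \<and> (\<forall>q'. section_of S ds {y. E y J} p (k + 1) q' \<longleftrightarrow> q' = q) \<and>
    (\<forall>a. E a J \<longrightarrow> ds q a \<le> 2 * k + 1)"
proof -
  obtain i where i: "inf_dist ds p {y. E y J} i"
    using inf_dist_exists[OF m p J] by blast
  define s where "s = max 0 (i - (k + 1))"
  have lower: "i \<le> ds p a" if "E a J" for a
    using i that by (simp add: inf_dist_def)
  have upper: "ds p a \<le> i + k" if a: "E a J" for a
  proof -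
    have "ds p a - k \<le> ds p b" if b: "E b J" for b
      using metricD(4)[OF m p, of b a] diam[OF b a] J(1)[OF a] J(1)[OF b] by simp
    then have "ds p a - k \<le> i" using i by (simp add: inf_dist_def)
    then show ?thesis by simp
  qed
  have s: "0 \<le> s" "s \<le> ds p a" if "E a J" for a
    using lower[OF that] metricD(1)[OF m p J(1)[OF that]] k unfolding s_def by auto
  have on: "\<exists>q. E q S \<and> E (pr (rep s) q) \<rho> \<and> ds q a \<le> 2 * k + 1" if a: "E a J" and g: "geodesic S ds p a \<rho>" for a \<rho>
  proof -
    from g obtain h where h: "\<And>c u. E (pr c u) \<rho> \<longleftrightarrow> (\<exists>s. c = rep s \<and> 0 \<le> s \<and> s \<le> ds p a \<and> u = h s)"
      "\<And>s. 0 \<le> s \<Longrightarrow> s \<le> ds p a \<Longrightarrow> E (h s) S"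
      "\<And>s t. 0 \<le> s \<Longrightarrow> s \<le> ds p a \<Longrightarrow> 0 \<le> t \<Longrightarrow> t \<le> ds p a \<Longrightarrow> ds (h s) (h t) = \<bar>s - t\<bar>"
      "h 0 = p" "h (ds p a) = a"
      by (rule geodesicE) blast
    have "ds (h s) a = ds p a - s"
      using h(3)[of s "ds p a"] s[OF a] h(5) by simp
    also have "\<dots> \<le> 2 * k + 1"
      using upper[OF a] unfolding s_def by (auto simp: max_def)
    finally show ?thesis using h(1,2) s[OF a] by blast
  qed
  have unique: "u = w" if "E a J" "E b J" "geodesic S ds p a \<rho>" "geodesic S ds p b \<sigma>"
    "E (pr (rep s) u) \<rho>" "E (pr (rep s) w) \<sigma>" for a b \<rho> \<sigma> u w
  proof (cases "i \<le> k + 1")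
    case True
    then have "s = 0" by (simp add: s_def)
    \<comment> \<open>For s = 0 uniqueness is immediate: a geodesic from p starts at p.\<close>
    have "u = p" if "E (pr (rep 0) u) \<rho>" "geodesic S ds p a \<rho>" for u a \<rho>
      using that unfolding geodesic_def fun_on_def by blast
    with that \<open>s = 0\<close> show ?thesis by metis
  next
    case False
    then have "s = i - (k + 1)" by (simp add: s_def)
    \<comment> \<open>Here d(p,a) + d(p,b) - d(a,b) \<ge> 2i - k, while 2s = 2i - 2k - 2; the
      summand 1 in the constant keeps the inequality strict even for k = 0.\<close>
    then have "2 * s < ds p a + ds p b - ds a b"
      using lower[of a] lower[of b] diam[of a b] that k by simp
    then show ?thesis
      using geodesics_agree[OF m t p _ _ that(3,4) _ that(5,6)] J(1) that(1,2) by blast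
  qed
  have ex: "\<exists>\<rho>. geodesic S ds p a \<rho>" if "E a J" for a
    using t p J(1)[OF that] unfolding tree_def by blast
  obtain \<rho> where \<rho>: "geodesic S ds p y0 \<rho>" using ex J(2) by blast
  obtain q where q: "E q S" "E (pr (rep s) q) \<rho>" using on[OF J(2) \<rho>] by blast
  have "section_of S ds {y. E y J} p (k + 1) q' \<longleftrightarrow> q' = q" for q'
  proof
    assume "section_of S ds {y. E y J} p (k + 1) q'"
    then obtain j a \<sigma> where "inf_dist ds p {y. E y J} j" and a: "E a J" "geodesic S ds p a \<sigma>"
      and j: "E (pr (rep (max 0 (j - (k + 1)))) q') \<sigma>"
      unfolding section_of_def by auto
    then have "j = i" using inf_dist_unique[OF _ i] by blast
    with j have "E (pr (rep s) q') \<sigma>" by (simp add: s_def)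
    then show "q' = q" using unique[OF a(1) J(2) a(2) \<rho> _ q(2)] by blast
  next
    assume "q' = q"
    then show "section_of S ds {y. E y J} p (k + 1) q'"
      using i J(2) \<rho> q(2) unfolding section_of_def s_def by blast
  qed
  moreover have "ds q a \<le> 2 * k + 1" if a: "E a J" for a
  proof -
    obtain \<sigma> where \<sigma>: "geodesic S ds p a \<sigma>" using ex a by blast
    obtain q' where "E (pr (rep s) q') \<sigma>" "ds q' a \<le> 2 * k + 1" using on[OF a \<sigma>] by blast
    then show ?thesis using unique[OF a J(2) \<sigma> \<rho> _ q(2)] by blast
  qed
  ultimately show ?thesis using q(1) by blast
qed

section \<open>Fibres, ranges and graphs obtained by Separation\<close>

lemma fibre_exists:
  assumes m: "metric T D' dt" and f: "fun_on f {x. E x S} {y. E y T}" and t: "E t T"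
  shows "\<exists>J. \<forall>x. E x J \<longleftrightarrow> E x S \<and> (\<exists>y. E (pr x y) f \<and> dt y t \<le> c)"
proof -
  note [simp] = metric_graph[OF m]
  have fT: "E y T" if "E (pr x y) f" for x y
    using f that unfolding fun_on_def by fastforce
  \<comment> \<open>The levels 6 to 9 hold the metric of T, f, t and the bound; 10 is the tested
    point. Being a set of the model is what gives the fibre an infimum of distances.\<close>
  let ?P = "app2 6 (app 7 (V 10)) (V 8) \<preceq>\<^bsub>reals\<^esub> V 9"
  obtain J where "\<And>x. E x J \<longleftrightarrow> E x S \<and> holds 11 ((assign [D', f, t, rep c])(10 := x)) ?P"
    using separation[of S 10 "assign [D', f, t, rep c]" ?P] by auto
  moreover have "holds 11 ((assign [D', f, t, rep c])(10 := x)) ?P \<longleftrightarrow> (\<exists>y. E (pr x y) f \<and> dt y t \<le> c)" for x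
    using t by (auto simp: term_defs assign_def dest: fT)
  ultimately show ?thesis by auto
qed

text \<open>Applied to the quasi-inverse, whose range must be a set of the model before the
  distances to it are known to have an infimum.\<close>

lemma range_exists:
  assumes "fun_on f {x. E x S} {y. E y T}"
  shows "\<exists>J. \<forall>y. E y J \<longleftrightarrow> (\<exists>x. E (pr x y) f)"
proof -
  have fT: "E y T" if "E (pr x y) f" for x y
    using assms that unfolding fun_on_def by fastforce
  obtain J where "\<And>y. E y J \<longleftrightarrow> E y T \<and> holds 8 ((assign [f])(7 := y)) (in_range 6 7)"
    using separation[of T 7 "assign [f]" "in_range 6 7"] by auto
  with fT show ?thesis by (intro exI[of _ J]) (auto simp: assign_def)
qed

text \<open>Here t is a bound variable, so its fibre enters as the predicate \<open>?A\<close> and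
  not as a set supplied from outside. One formula with the fixed parameters S, D, T, D', f, c, p and
  k defines the graph for all t at once, which is why no choice is involved.\<close>

lemma section_exists:
  assumes m: "metric S D ds" "metric T D' dt" and f: "fun_on f {x. E x S} {y. E y T}" and p: "E p S"
  shows "\<exists>g. \<forall>z. E z g \<longleftrightarrow> (\<exists>t q. z = pr t q \<and> E t T \<and> E q S \<and>
    section_of S ds {x. E x S \<and> (\<exists>y. E (pr x y) f \<and> dt y t \<le> c)} p k q)"
proof -
  note graph [simp] = metric_graph[OF m(1)] metric_graph[OF m(2)]
  have fT: "E y T" if "E (pr x y) f" for x y
    using f that unfolding fun_on_def by fastforce
  let ?A = "\<lambda>t x. x \<^bold>\<in> 6 \<^bold>\<and> (app2 9 (app 10 (V x)) (V t) \<preceq>\<^bsub>reals\<^esub> V 11)"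
  let ?X = "\<lambda>t. {x. E x S \<and> (\<exists>y. E (pr x y) f \<and> dt y t \<le> c)}"
  let ?v = "assign [S, D, T, D', f, rep c, p, rep k]"
  have v: "?v 6 = S" "?v 7 = D" "?v 8 = T" "?v 9 = D'" "?v 10 = f" "?v 11 = rep c" "?v 12 = p" "?v 13 = rep k"
    and base: "?v 0 = R" "?v (Suc 0) = rep 0" "?v 2 = rep 1" "?v 3 = add" "?v 4 = mul" "?v 5 = le"
    by (simp_all add: assign_def)
  have A: "holds d w (?A t x) \<longleftrightarrow> w x \<in> ?X (w t)"
    if "14 \<le> d" "\<And>i. i < 14 \<Longrightarrow> w i = ?v i" "t < d" "x < d" "E (w t) T" for d w t x
    using that by (auto simp: term_defs v base dest: fT)
  \<comment> \<open>Here m is the infimum, a a point of the fibre and s = max 0 (m - k), given by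
    cases: level \<open>Suc 0\<close> is the zero, and m - k is the solution of s + k = m.\<close>
  let ?Q = "\<lambda>z t q. is_pair z t q \<^bold>\<and> (\<^bold>\<exists>m. is_set_dist reals 7 12 (?A t) m \<^bold>\<and>
      (\<^bold>\<exists>a. ?A t a \<^bold>\<and> (\<^bold>\<exists>s\<^bold>\<in>0. ((V m \<preceq>\<^bsub>reals\<^esub> V 13) \<^bold>\<and> s \<^bold>= Suc 0 \<^bold>\<or>
        \<^bold>\<not> (V m \<preceq>\<^bsub>reals\<^esub> V 13) \<^bold>\<and> (V s \<oplus>\<^bsub>reals\<^esub> V 13 \<^bold>\<doteq> V m)) \<^bold>\<and>
        (\<^bold>\<exists>\<rho>. is_geodesic reals 6 7 12 a \<rho> \<^bold>\<and> pair_in \<rho> s q))))"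
  have Q: "holds 17 w (?Q 14 15 16) \<longleftrightarrow> w 14 = pr (w 15) (w 16) \<and> section_of S ds (?X (w 15)) p k (w 16)"
    if w: "\<And>i. i < 14 \<Longrightarrow> w i = ?v i" and T: "E (w 15) T" for w
  proof -
    have dist: "holds 18 (w(17 := m)) (is_set_dist reals 7 12 (?A 15) 17) \<longleftrightarrow>
        (\<exists>r. m = rep r \<and> inf_dist ds p (?X (w 15)) r)" for m
    proof -
      let ?w = "w(17 := m)"
      have "denotes 18 ?w (?A 15) (?X (w 15))"
        unfolding denotes_def
      proof clarify
        fix d u x assume u: "18 \<le> d" "\<forall>i<18. u i = ?w i" "x < (d :: nat)"
        then have "u 15 = w 15" by simp
        moreover have "u i = ?v i" if "i < 14" for i
          using u(2) that w by simp
        ultimately show "holds d u (?A 15 x) \<longleftrightarrow> u x \<in> ?X (w 15)"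
          using A[of d u 15 x] T u by simp
      qed
      then have "holds 18 ?w (is_set_dist reals 7 12 (?A 15) 17) \<longleftrightarrow>
          (\<exists>r. ?w 17 = rep r \<and> inf_dist ds (?w 12) (?X (w 15)) r)"
        by (intro holds_is_set_dist[where S = 6]) (use w m p in \<open>auto simp: v base\<close>)
      then show ?thesis using w by (simp add: v)
    qed
    have W: "w 6 = S" "w 9 = D'" "w 10 = f" "w 11 = rep c" "w 13 = rep k" "w 0 = R" "w (Suc 0) = rep 0"
      "w 3 = add" "w 5 = le"
      using w by (simp_all add: v base)
    have A': "holds 19 (w(17 := m, 18 := a)) (app2 9 (app 10 (V 18)) (V 15) \<preceq>\<^bsub>reals\<^esub> V 11) \<longleftrightarrow>
        (\<exists>y. E (pr a y) f \<and> dt y (w 15) \<le> c)" for m a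
      using T fT by (auto simp: term_defs W)
    have ex_rep: "(\<exists>a. (\<exists>r. a = rep r \<and> P r) \<and> Q a) \<longleftrightarrow> (\<exists>r. P r \<and> Q (rep r))" for P Q
      by auto
    have geo: "holds 21 (w(17 := m, 18 := a, 19 := s, 20 := \<rho>)) (is_geodesic reals 6 7 12 18 20) \<longleftrightarrow>
        geodesic S ds p a \<rho>" if "E a S" for m a s \<rho>
      using holds_is_geodesic[of 21 "w(17 := m, 18 := a, 19 := s, 20 := \<rho>)" 6 7 12 18 20 ds] w m p that
      by (simp add: v base)
    have max: "(r \<le> k \<and> s = 0 \<or> \<not> r \<le> k \<and> s + k = r) \<longleftrightarrow> s = max 0 (r - k)" for r s :: 'r
      by (auto simp: max_def)
    show ?thesis
      by (simp add: dist A' W ex_rep cong: conj_cong)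
        (auto simp: geo tLe_def tEq_def tAdd_def app2_def V_def W max section_of_def cong: conj_cong)
  qed
  \<comment> \<open>Separation needs a set that already contains all pairs from T and S.\<close>
  obtain c' where c': "\<And>t q. E t T \<Longrightarrow> E q S \<Longrightarrow> E (pr t q) c'"
    using product_exists[of T S] by blast
  let ?P = "\<^bold>\<exists>t\<^bold>\<in>8. \<^bold>\<exists>q\<^bold>\<in>6. ?Q 14 t q"
  obtain g where g: "\<And>z. E z g \<longleftrightarrow> E z c' \<and> holds 15 (?v(14 := z)) ?P"
    using separation[of c' 14 ?v ?P] by auto
  have "holds 15 (?v(14 := z)) ?P \<longleftrightarrow>
      (\<exists>t. E t T \<and> (\<exists>q. E q S \<and> holds 17 (?v(14 := z, 15 := t, 16 := q)) (?Q 14 15 16)))" for z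
    by (simp add: v del: holds_connectives)
  moreover have "holds 17 (?v(14 := z, 15 := t, 16 := q)) (?Q 14 15 16) \<longleftrightarrow>
      z = pr t q \<and> section_of S ds (?X t) p k q" if "E t T" for z t q
    using Q[of "?v(14 := z, 15 := t, 16 := q)"] that by simp
  ultimately have "holds 15 (?v(14 := z)) ?P \<longleftrightarrow>
      (\<exists>t q. z = pr t q \<and> E t T \<and> E q S \<and> section_of S ds (?X t) p k q)" for z
    by blast
  with g c' show ?thesis by (intro exI[of _ g]) blast
qed

section \<open>The quasi-inverse and its constants\<close>

theorem quasi_inverse:
  assumes m: "metric S D ds" "metric T D' dt" and t: "tree S ds" and q: "quasi_isometry S ds T dt f"
  shows "\<exists>g. quasi_isometry T dt S ds g"
proof (cases "\<exists>p. E p S")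
  case False
  with q show ?thesis by (rule quasi_isometry_from_empty)
next
  case True
  then obtain p where p: "E p S" by blast
  have f: "fun_on f {x. E x S} {y. E y T}"
    using q by (simp add: quasi_isometry_def)
  then obtain h where h: "\<And>x y. E (pr x y) f \<longleftrightarrow> x \<in> {x. E x S} \<and> y = h x" and "h ` {x. E x S} \<subseteq> {y. E y T}"
    by (rule fun_onE) blast
  then have h': "\<And>x y. E (pr x y) f \<longleftrightarrow> E x S \<and> y = h x" and hT: "\<And>x. E x S \<Longrightarrow> E (h x) T"
    by auto
  obtain n where n: "n \<ge> 1" and surj: "\<And>y. E y T \<Longrightarrow> \<exists>q\<le>n. inf_dist dt y {y. \<exists>x. E x S \<and> y = h x} q"
    and qi: "\<And>x y. E x S \<Longrightarrow> E y S \<Longrightarrow> ds x y / n - n \<le> dt (h x) (h y)"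
      "\<And>x y. E x S \<Longrightarrow> E y S \<Longrightarrow> dt (h x) (h y) \<le> n * ds x y + n"
    using q unfolding quasi_isometry_def by (auto simp: h')
  have qi': "ds x y \<le> n * (dt (h x) (h y) + n)" if "E x S" "E y S" for x y
    using qi(1)[OF that] n by (simp add: field_simps)
  \<comment> \<open>The distance from t to the image of f is an infimum, at most n but perhaps not
    attained; the radius n + 1 makes the fibre nonempty.\<close>
  define A where "A t = {x. E x S \<and> (\<exists>y. E (pr x y) f \<and> dt y t \<le> n + 1)}" for t
  have A: "a \<in> A t \<longleftrightarrow> E a S \<and> dt (h a) t \<le> n + 1" for a t
    by (auto simp: A_def h')
  \<comment> \<open>Two points of A t have images within 2(n + 1) of each other, and
    \<open>qi'\<close> turns this into a distance of at most n(2(n + 1) + n).\<close>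
  define k where "k = n * (3 * n + 2)"
  have k: "0 \<le> k" using n by (simp add: k_def)
  have q_exists: "\<exists>q. E q S \<and> (\<forall>q'. section_of S ds (A t) p (k + 1) q' \<longleftrightarrow> q' = q) \<and>
      (\<forall>a\<in>A t. ds q a \<le> 2 * k + 1)" and A_ex: "\<exists>a. a \<in> A t" if T: "E t T" for t
  proof -
    obtain r where "r \<le> n" "inf_dist dt t {y. \<exists>x. E x S \<and> y = h x} r" using surj[OF T] by blast
    with inf_dist_approx[of dt t _ r "n + 1"] obtain a where a: "E a S" "dt t (h a) < n + 1" by auto
    then have a': "a \<in> A t" using metricD(3)[OF m(2) T hT[OF a(1)]] by (simp add: A)
    then show "\<exists>a. a \<in> A t" ..
    obtain J where "\<And>x. E x J \<longleftrightarrow> x \<in> A t"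
      using fibre_exists[OF m(2) f T, of "n + 1"] by (auto simp: A_def)
    then have J: "{x. E x J} = A t" "\<And>x. E x J \<longleftrightarrow> x \<in> A t" by auto
    have "ds a b \<le> k" if "a \<in> A t" "b \<in> A t" for a b
    proof -
      have ab: "E a S" "E b S" "dt (h a) t \<le> n + 1" "dt (h b) t \<le> n + 1" using that by (auto simp: A)
      have "dt (h a) (h b) \<le> dt (h a) t + dt t (h b)" "dt t (h b) = dt (h b) t"
        by (rule metricD(4)[OF m(2)] metricD(3)[OF m(2)]; use ab hT T in simp)+
      then have "dt (h a) (h b) + n \<le> 3 * n + 2" using ab by simp
      then have "n * (dt (h a) (h b) + n) \<le> k"
        unfolding k_def using n by (intro mult_left_mono) auto
      with qi'[OF ab(1,2)] show ?thesis by simp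
    qed
    then have "\<exists>q. E q S \<and> (\<forall>q'. section_of S ds {y. E y J} p (k + 1) q' \<longleftrightarrow> q' = q) \<and>
      (\<forall>a. E a J \<longrightarrow> ds q a \<le> 2 * k + 1)"
      using k a' by (intro section_of_unique_close[OF m(1) t p]) (auto simp: J A)
    then show "\<exists>q. E q S \<and> (\<forall>q'. section_of S ds (A t) p (k + 1) q' \<longleftrightarrow> q' = q) \<and>
      (\<forall>a\<in>A t. ds q a \<le> 2 * k + 1)"
      by (simp add: J Ball_def)
  qed
  define r where "r t = (THE q. section_of S ds (A t) p (k + 1) q)" for t
  have r: "E (r t) S" "section_of S ds (A t) p (k + 1) q \<longleftrightarrow> q = r t" "a \<in> A t \<Longrightarrow> ds (r t) a \<le> 2 * k + 1"
    if "E t T" for t q a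
    using q_exists[OF that] by (auto simp: r_def)
  obtain g where g: "\<And>z. E z g \<longleftrightarrow> (\<exists>t q. z = pr t q \<and> E t T \<and> E q S \<and> section_of S ds (A t) p (k + 1) q)"
    using section_exists[OF m f p, of "n + 1" "k + 1"] by (auto simp: A_def)
  have g': "E (pr t q) g \<longleftrightarrow> E t T \<and> q = r t" for t q
    using r by (auto simp: g)
  have fg: "fun_on g {t. E t T} {q. E q S}"
    unfolding fun_on_def using r g by (auto simp: g')
  \<comment> \<open>The error 2(2k + 1) of replacing a and b by \<open>r t\<close> and
    \<open>r u\<close>, scaled by the factor n of the upper bound for f.\<close>
  define K where "K = 2 * n * (2 * k + 1)"
  have K: "0 \<le> K" using n k by (simp add: K_def)
  obtain N where N: "natural N" "n + (3 * n + 2) + K + 2 * (2 * k + 1) + k \<le> N"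
    using archimedean by blast
  have N1: "1 \<le> N" "n \<le> N" "2 * k + 1 \<le> N" "3 * n + 2 + K \<le> N" "2 * (2 * k + 1) + k \<le> N"
    using N(2) K n k by auto
  have "\<exists>q\<le>N. inf_dist ds x {y. \<exists>t. E t T \<and> y = r t} q" if x: "E x S" for x
  proof -
    obtain J where J: "\<And>y. E y J \<longleftrightarrow> (\<exists>t. E t T \<and> y = r t)"
      using range_exists[OF fg] by (auto simp: g')
    then obtain q where q: "inf_dist ds x {y. \<exists>t. E t T \<and> y = r t} q"
      using inf_dist_exists[OF m(1) x, of J "r (h x)"] r(1) hT[OF x] by auto
    \<comment> \<open>x lies in the fibre over its own image, so \<open>r (h x)\<close> is a point
      of the range near x.\<close>
    have "x \<in> A (h x)" using x n metricD(2)[OF m(2) hT[OF x] hT[OF x]] by (simp add: A)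
    then have "ds x (r (h x)) \<le> 2 * k + 1"
      using r(1,3)[OF hT[OF x]] metricD(3)[OF m(1) x] by simp
    moreover have "q \<le> ds x (r (h x))" using q hT[OF x] unfolding inf_dist_def by blast
    ultimately show ?thesis using q N1(3) by (intro exI[of _ q]) simp
  qed
  moreover have "dt t u / N - N \<le> ds (r t) (r u) \<and> ds (r t) (r u) \<le> N * dt t u + N" if tu: "E t T" "E u T" for t u
  proof -
    \<comment> \<open>These points are picked for a single pair t, u to prove an inequality; the map
      itself does not depend on them.\<close>
    obtain a b where a: "a \<in> A t" and b: "b \<in> A u" using A_ex tu by blast
    then have S: "E a S" "E b S" and T: "dt (h a) t \<le> n + 1" "dt (h b) u \<le> n + 1" by (auto simp: A)
    have "ds (r t) (r u) \<le> ds (r t) a + ds a (r u)" "ds a (r u) \<le> ds a b + ds b (r u)" "ds b (r u) = ds (r u) b"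
      "ds a b \<le> ds a (r t) + ds (r t) b" "ds (r t) b \<le> ds (r t) (r u) + ds (r u) b" "ds a (r t) = ds (r t) a"
      by (rule metricD(4)[OF m(1)] metricD(3)[OF m(1)]; use S r tu in simp)+
    then have S1: "ds (r t) (r u) \<le> ds a b + 2 * (2 * k + 1)" "ds a b \<le> ds (r t) (r u) + 2 * (2 * k + 1)"
      using r(3)[OF tu(1) a] r(3)[OF tu(2) b] by simp_all
    have "dt t u \<le> dt t (h a) + dt (h a) u" "dt (h a) u \<le> dt (h a) (h b) + dt (h b) u" "dt t (h a) = dt (h a) t"
      "dt (h a) (h b) \<le> dt (h a) t + dt t (h b)" "dt t (h b) \<le> dt t u + dt u (h b)" "dt u (h b) = dt (h b) u"
      by (rule metricD(4)[OF m(2)] metricD(3)[OF m(2)]; use S tu hT in simp)+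
    then have T1: "dt t u \<le> dt (h a) (h b) + (2 * n + 2)" "dt (h a) (h b) \<le> dt t u + (2 * n + 2)"
      using T by simp_all
    have nn: "0 \<le> dt t u" "0 \<le> ds (r t) (r u)"
      using metricD(1)[OF m(2) tu] metricD(1)[OF m(1) r(1)[OF tu(1)] r(1)[OF tu(2)]] by auto
    have "n * (dt (h a) (h b) + n) \<le> n * (dt t u + (3 * n + 2))"
      using T1(2) n by (intro mult_left_mono) auto
    then have "ds (r t) (r u) \<le> n * dt t u + k + 2 * (2 * k + 1)"
      using S1(1) qi'[OF S] by (simp add: k_def distrib_left)
    moreover have "n * dt t u \<le> N * dt t u" using N1(2) nn by (intro mult_right_mono)
    ultimately have up: "ds (r t) (r u) \<le> N * dt t u + N" using N1(5) by simp
    have "n * ds a b \<le> n * (ds (r t) (r u) + 2 * (2 * k + 1))"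
      using S1(2) n by (intro mult_left_mono) auto
    then have "n * ds a b \<le> n * ds (r t) (r u) + K"
      by (simp add: K_def algebra_simps)
    moreover have "n * ds (r t) (r u) \<le> N * ds (r t) (r u)" using N1(2) nn by (intro mult_right_mono)
    ultimately have "dt t u \<le> N * ds (r t) (r u) + N"
      using T1(1) qi(2)[OF S] N1(4) by simp
    \<comment> \<open>The lower estimate has the form d/N - N, so after multiplication by N the
      admissible error is N * N.\<close>
    also have "\<dots> \<le> N * ds (r t) (r u) + N * N"
      using N1(1) mult_left_mono[of 1 N N] by simp
    finally have "dt t u \<le> (ds (r t) (r u) + N) * N" by (simp add: algebra_simps)
    then have "dt t u / N \<le> ds (r t) (r u) + N" using N1(1) by (simp add: pos_divide_le_eq)
    then show ?thesis using up by simp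
  qed
  ultimately have "quasi_isometry T dt S ds g"
    unfolding quasi_isometry_def using fg N(1) N1(1) by (intro conjI exI[of _ N]) (auto simp: g')
  then show ?thesis ..
qed

lemma quasi_isometries_reversible:
  assumes b: "base 6 v"
  shows "holds 6 v (\<^bold>\<forall>S dS T dT. is_real_tree reals S dS \<^bold>\<and> is_real_tree reals T dT \<^bold>\<longrightarrow>
    (\<^bold>\<exists>f. is_quasi_isometry reals S dS T dT f) \<^bold>\<longrightarrow> (\<^bold>\<exists>g. is_quasi_isometry reals T dT S dS g))"
proof -
  have "\<exists>g. holds 11 (v(6 := S, 7 := D, 8 := T, 9 := D', 10 := g)) (is_quasi_isometry reals 8 9 6 7 10)"
    if S: "holds 10 (v(6 := S, 7 := D, 8 := T, 9 := D')) (is_real_tree reals 6 7)"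
      and T: "holds 10 (v(6 := S, 7 := D, 8 := T, 9 := D')) (is_real_tree reals 8 9)"
      and f: "holds 11 (v(6 := S, 7 := D, 8 := T, 9 := D', 10 := f)) (is_quasi_isometry reals 6 7 8 9 10)"
    for S D T D' f
  proof -
    obtain ds where ds: "metric S D ds" "tree S ds"
      using holds_is_real_tree[OF _ _ _ S] b by auto
    obtain dt where dt: "metric T D' dt"
      using holds_is_real_tree[OF _ _ _ T] b by auto
    have "quasi_isometry S ds T dt f"
      using holds_is_quasi_isometry[of 11 "v(6 := S, 7 := D, 8 := T, 9 := D', 10 := f)" 6 7 8 9 10 ds dt] f b ds dt
      by simp
    then obtain g where "quasi_isometry T dt S ds g"
      using quasi_inverse[OF ds(1) dt ds(2)] by blast
    then show ?thesis
      using holds_is_quasi_isometry[of 11 "v(6 := S, 7 := D, 8 := T, 9 := D', 10 := g)" 8 9 6 7 10 dt ds] b ds dt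
      by (intro exI[of _ g]) simp
  qed
  then show ?thesis by simp blast
qed

end


section \<open>The field of a counterexample as a type\<close>

text \<open>HOL has no types that depend on a model, so the field of an arbitrary model cannot be turned into
  an instance of \<open>linordered_field\<close>. But one global type is enough if it is
  the field of some counterexample to the theorem, should there be one, and the rational
  numbers otherwise: if its field satisfies the theorem, then there was no counterexample.\<close>

record 'a field_structure =
  elements :: "'a set"
  zero :: 'a
  unit :: 'a
  plus :: "'a \<Rightarrow> 'a \<Rightarrow> 'a"
  mult :: "'a \<Rightarrow> 'a \<Rightarrow> 'a"
  leq :: "'a \<Rightarrow> 'a \<Rightarrow> bool"

text \<open>Bounded quantifiers are spelled out as implications, the shape of the translated axioms,
  so that these fit without further rewriting.\<close>

definition ordered_field :: "'a field_structure \<Rightarrow> bool" where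
  "ordered_field K \<longleftrightarrow> (let C = elements K; z = zero K; u = unit K; p = plus K; m = mult K; l = leq K in
    z \<in> C \<and> u \<in> C \<and> z \<noteq> u \<and>
    (\<forall>x. x \<in> C \<longrightarrow> (\<forall>y. y \<in> C \<longrightarrow> p x y \<in> C \<and> m x y \<in> C)) \<and>
    (\<forall>x. x \<in> C \<longrightarrow> (\<forall>y. y \<in> C \<longrightarrow> (\<forall>z. z \<in> C \<longrightarrow>
      p (p x y) z = p x (p y z) \<and> m (m x y) z = m x (m y z) \<and> m x (p y z) = p (m x y) (m x z)))) \<and>
    (\<forall>x. x \<in> C \<longrightarrow> (\<forall>y. y \<in> C \<longrightarrow> p x y = p y x \<and> m x y = m y x)) \<and>
    (\<forall>x. x \<in> C \<longrightarrow> p x z = x \<and> m x u = x) \<and>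
    (\<forall>x. x \<in> C \<longrightarrow> (\<exists>y. y \<in> C \<and> p x y = z)) \<and>
    (\<forall>x. x \<in> C \<longrightarrow> x \<noteq> z \<longrightarrow> (\<exists>y. y \<in> C \<and> m x y = u)) \<and>
    (\<forall>x. x \<in> C \<longrightarrow> (\<forall>y. y \<in> C \<longrightarrow> l x y \<or> l y x)) \<and>
    (\<forall>x. x \<in> C \<longrightarrow> (\<forall>y. y \<in> C \<longrightarrow> l x y \<and> l y x \<longrightarrow> x = y)) \<and>
    (\<forall>x. x \<in> C \<longrightarrow> (\<forall>y. y \<in> C \<longrightarrow> (\<forall>z. z \<in> C \<longrightarrow> l x y \<and> l y z \<longrightarrow> l x z))) \<and>
    (\<forall>x. x \<in> C \<longrightarrow> (\<forall>y. y \<in> C \<longrightarrow> (\<forall>z. z \<in> C \<longrightarrow> l x y \<longrightarrow> l (p x z) (p y z)))) \<and>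
    (\<forall>x. x \<in> C \<longrightarrow> (\<forall>y. y \<in> C \<longrightarrow> l z x \<and> l z y \<longrightarrow> l z (m x y))))"

text \<open>Completeness refers to the sets of a particular model, so it belongs here and not to
  \<open>ordered_field\<close>, which knows only the structure itself.\<close>

definition (in ZF_model) presents :: "(nat \<Rightarrow> 'm) \<Rightarrow> 'm field_structure \<Rightarrow> bool" where
  "presents v K \<longleftrightarrow> elements K = {x. E x (v 0)} \<and> zero K = v (Suc 0) \<and> unit K = v 2 \<and>
    (\<forall>x y c. E (pr (pr x y) c) (v 3) \<longleftrightarrow> E x (v 0) \<and> E y (v 0) \<and> c = plus K x y) \<and>
    (\<forall>x y c. E (pr (pr x y) c) (v 4) \<longleftrightarrow> E x (v 0) \<and> E y (v 0) \<and> c = mult K x y) \<and>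
    (\<forall>x y. E (pr x y) (v 5) \<longleftrightarrow> E x (v 0) \<and> E y (v 0) \<and> leq K x y) \<and>
    (\<forall>A a b. (\<forall>x. E x A \<longrightarrow> E x (v 0)) \<and> E a A \<and> E b (v 0) \<and> (\<forall>x. E x A \<longrightarrow> leq K x b) \<longrightarrow>
      (\<exists>s. E s (v 0) \<and> (\<forall>x. E x A \<longrightarrow> leq K x s) \<and>
        (\<forall>b. E b (v 0) \<and> (\<forall>x. E x A \<longrightarrow> leq K x b) \<longrightarrow> leq K s b)))"

lemma (in ZF_model) field_structure_exists:
  assumes c: "holds 6 v (is_complete_ordered_field reals)"
  shows "\<exists>K. ordered_field K \<and> presents v K"
proof -
  let ?R = "{x. E x (v 0)}"
  have bin: "\<exists>h. (\<forall>x y c. E (pr (pr x y) c) (v g) \<longleftrightarrow> E x (v 0) \<and> E y (v 0) \<and> c = h x y) \<and>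
      (\<forall>x y. E x (v 0) \<longrightarrow> E y (v 0) \<longrightarrow> E (h x y) (v 0))"
    if "holds 6 v (is_binary_function g 0 0)" "g < 6" for g
  proof -
    let ?A = "{p. \<exists>x y. E x (v 0) \<and> E y (v 0) \<and> p = pr x y}"
    have "denotes 6 v (\<lambda>p. \<^bold>\<exists>x\<^bold>\<in>0. \<^bold>\<exists>y\<^bold>\<in>0. is_pair p x y) ?A"
      by (auto simp: denotes_def)
    moreover have "denotes 6 v (elem 0) ?R"
      by (auto simp: denotes_def)
    ultimately have "fun_on (v g) ?A ?R"
      using that by (simp add: is_binary_function_def holds_is_function)
    then obtain h where "\<And>x y. E (pr x y) (v g) \<longleftrightarrow> x \<in> ?A \<and> y = h x" "h ` ?A \<subseteq> ?R"
      by (rule fun_onE) blast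
    then show ?thesis
      by (intro exI[of _ "\<lambda>x y. h (pr x y)"]) (auto simp: image_subset_iff)
  qed
  have "holds 6 v (is_binary_function 3 0 0)" "holds 6 v (is_binary_function 4 0 0)"
    using c by (simp_all add: is_complete_ordered_field_def is_ordered_field_def is_field_def Let_def)
  with bin[of 3] bin[of 4] obtain pl ti where
    pl: "\<And>x y c. E (pr (pr x y) c) (v 3) \<longleftrightarrow> E x (v 0) \<and> E y (v 0) \<and> c = pl x y"
      "\<And>x y. E x (v 0) \<Longrightarrow> E y (v 0) \<Longrightarrow> E (pl x y) (v 0)" and
    ti: "\<And>x y c. E (pr (pr x y) c) (v 4) \<longleftrightarrow> E x (v 0) \<and> E y (v 0) \<and> c = ti x y"
      "\<And>x y. E x (v 0) \<Longrightarrow> E y (v 0) \<Longrightarrow> E (ti x y) (v 0)"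
    by auto
  let ?le = "\<lambda>x y. E (pr x y) (v 5)"
  have of: "holds 6 v (is_ordered_field reals)" and fld: "holds 6 v (is_field reals)"
    using c by (simp_all add: is_complete_ordered_field_def is_ordered_field_def Let_def)
  have "\<forall>p. E p (v 5) \<longrightarrow> (\<exists>x. E x (v 0) \<and> (\<exists>y. E y (v 0) \<and> p = pr x y))"
    using of by (simp add: is_ordered_field_def Let_def)
  then have le: "E x (v 0) \<and> E y (v 0)" if "E (pr x y) (v 5)" for x y
    using that by fastforce
  note [simp] = pl ti
  note fld' = fld[unfolded is_field_def Let_def term_defs, simplified]
    and of' = of[unfolded is_ordered_field_def Let_def term_defs, simplified]
    and c' = c[unfolded is_complete_ordered_field_def is_upper_bound_def term_defs, simplified]
  let ?K = "\<lparr>elements = ?R, zero = v (Suc 0), unit = v 2, plus = pl, mult = ti, leq = ?le\<rparr>"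
  have "ordered_field ?K"
  proof -
    have "\<forall>x. E x (v 0) \<longrightarrow> E (v (Suc 0)) (v 0) \<and> pl x (v (Suc 0)) = x \<and> E (v 2) (v 0) \<and> ti x (v 2) = x"
      using fld' by (elim conjE)
    then have unit: "\<forall>x. E x (v 0) \<longrightarrow> pl x (v (Suc 0)) = x \<and> ti x (v 2) = x"
      by simp
    have cl: "\<forall>x. E x (v 0) \<longrightarrow> (\<forall>y. E y (v 0) \<longrightarrow> E (pl x y) (v 0) \<and> E (ti x y) (v 0))"
      using pl(2) ti(2) by simp
    note z = fld'[THEN conjunct2, THEN conjunct2]
    note u = z[THEN conjunct2]
    note neq = u[THEN conjunct2]
    note assoc = neq[THEN conjunct2]
    note comm = assoc[THEN conjunct2]
    note inv = comm[THEN conjunct2, THEN conjunct2]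
    note total = of'[THEN conjunct2, THEN conjunct2]
    note antisym = total[THEN conjunct2]
    note trans = antisym[THEN conjunct2]
    show ?thesis
      unfolding ordered_field_def Let_def field_structure.simps mem_Collect_eq
      by (intro conjI cl unit z[THEN conjunct1] u[THEN conjunct1] neq[THEN conjunct1] assoc[THEN conjunct1] comm[THEN conjunct1]
         inv[THEN conjunct1] inv[THEN conjunct2] total[THEN conjunct1] antisym[THEN conjunct1] trans[THEN conjunct1] trans[THEN conjunct2, THEN conjunct1] trans[THEN conjunct2, THEN conjunct2])
  qed
  moreover have "\<exists>s. E s (v 0) \<and> (\<forall>x. E x A \<longrightarrow> ?le x s) \<and>
      (\<forall>b. E b (v 0) \<and> (\<forall>x. E x A \<longrightarrow> ?le x b) \<longrightarrow> ?le s b)"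
    if "\<forall>x. E x A \<longrightarrow> E x (v 0)" "E a A" "E b (v 0)" "\<forall>x. E x A \<longrightarrow> ?le x b" for A a b
    using c'[THEN conjunct2, THEN spec, of A] that by blast
  ultimately show ?thesis
    unfolding presents_def using le by (intro exI[of _ ?K]) (auto simp del: pl ti simp add: pl(1) ti(1))
qed


lemma ordered_fieldD:
  assumes "ordered_field K"
  shows "zero K \<in> elements K" "unit K \<in> elements K" "zero K \<noteq> unit K"
    and "x \<in> elements K \<Longrightarrow> plus K x (zero K) = x" "x \<in> elements K \<Longrightarrow> mult K x (unit K) = x"
    and "x \<in> elements K \<Longrightarrow> \<exists>y\<in>elements K. plus K x y = zero K"
    and "x \<in> elements K \<Longrightarrow> x \<noteq> zero K \<Longrightarrow> \<exists>y\<in>elements K. mult K x y = unit K"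
    and "x \<in> elements K \<Longrightarrow> y \<in> elements K \<Longrightarrow> plus K x y \<in> elements K"
    and "x \<in> elements K \<Longrightarrow> y \<in> elements K \<Longrightarrow> mult K x y \<in> elements K"
    and "x \<in> elements K \<Longrightarrow> y \<in> elements K \<Longrightarrow> plus K x y = plus K y x"
    and "x \<in> elements K \<Longrightarrow> y \<in> elements K \<Longrightarrow> mult K x y = mult K y x"
    and "x \<in> elements K \<Longrightarrow> y \<in> elements K \<Longrightarrow> leq K x y \<or> leq K y x"
    and "x \<in> elements K \<Longrightarrow> y \<in> elements K \<Longrightarrow> leq K x y \<Longrightarrow> leq K y x \<Longrightarrow> x = y"
    and "x \<in> elements K \<Longrightarrow> y \<in> elements K \<Longrightarrow> leq K (zero K) x \<Longrightarrow> leq K (zero K) y \<Longrightarrow> leq K (zero K) (mult K x y)"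
    and "x \<in> elements K \<Longrightarrow> y \<in> elements K \<Longrightarrow> z \<in> elements K \<Longrightarrow> plus K (plus K x y) z = plus K x (plus K y z)"
    and "x \<in> elements K \<Longrightarrow> y \<in> elements K \<Longrightarrow> z \<in> elements K \<Longrightarrow> mult K (mult K x y) z = mult K x (mult K y z)"
    and "x \<in> elements K \<Longrightarrow> y \<in> elements K \<Longrightarrow> z \<in> elements K \<Longrightarrow> mult K x (plus K y z) = plus K (mult K x y) (mult K x z)"
    and "x \<in> elements K \<Longrightarrow> y \<in> elements K \<Longrightarrow> z \<in> elements K \<Longrightarrow> leq K x y \<Longrightarrow> leq K y z \<Longrightarrow> leq K x z"
    and "x \<in> elements K \<Longrightarrow> y \<in> elements K \<Longrightarrow> z \<in> elements K \<Longrightarrow> leq K x y \<Longrightarrow> leq K (plus K x z) (plus K y z)"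
  using assms unfolding ordered_field_def Let_def Bex_def by (elim conjE; metis)+

text \<open>The rationals are coded by natural numbers to share the type of the fields found in
  models on \<open>nat\<close>.\<close>

definition rat_field :: "nat field_structure" where
  "rat_field = \<lparr>elements = range (to_nat :: rat \<Rightarrow> nat), zero = to_nat (0 :: rat), unit = to_nat (1 :: rat),
    plus = (\<lambda>x y. to_nat (from_nat x + from_nat y :: rat)),
    mult = (\<lambda>x y. to_nat (from_nat x * from_nat y :: rat)),
    leq = (\<lambda>x y. (from_nat x :: rat) \<le> from_nat y)\<rparr>"

lemma ordered_field_rat_field: "ordered_field rat_field"
proof -
  have inverse: "\<exists>y. y \<in> range (to_nat :: rat \<Rightarrow> nat) \<and> to_nat (q * from_nat y) = to_nat (1 :: rat)" if "q \<noteq> 0" for q :: rat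
    using that by (intro exI[of _ "to_nat (1 / q)"]) simp
  have neg: "\<exists>y. y \<in> range (to_nat :: rat \<Rightarrow> nat) \<and> to_nat (q + from_nat y) = to_nat (0 :: rat)" for q :: rat
    by (intro exI[of _ "to_nat (- q)"]) simp
  show ?thesis
    unfolding ordered_field_def rat_field_def Let_def
    using inverse neg by (auto simp: algebra_simps)
qed

abbreviation reversible :: form where
  "reversible \<equiv> (\<^bold>\<forall>S dS T dT. is_real_tree reals S dS \<^bold>\<and> is_real_tree reals T dT \<^bold>\<longrightarrow>
    (\<^bold>\<exists>f. is_quasi_isometry reals S dS T dT f) \<^bold>\<longrightarrow> (\<^bold>\<exists>g. is_quasi_isometry reals T dT S dS g))"

definition counterexample :: "nat field_structure \<Rightarrow> bool" where
  "counterexample K \<longleftrightarrow> ordered_field K \<and> (\<exists>E e v. ZF_model E e \<and> ZF_model.presents E v K \<and>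
     \<not> set_model.holds E e 6 v reversible)"

definition chosen_field :: "nat field_structure" where
  "chosen_field = (if Ex counterexample then Eps counterexample else rat_field)"

lemma ordered_field_chosen: "ordered_field chosen_field"
proof (cases "Ex counterexample")
  case True
  then have "counterexample (Eps counterexample)" by (rule someI_ex)
  with True show ?thesis unfolding chosen_field_def by (simp add: counterexample_def[of "Eps _"])
next
  case False
  then show ?thesis unfolding chosen_field_def using ordered_field_rat_field by (simp only: if_False)
qed

section \<open>The elements of the chosen field as an ordered field type\<close>

typedef chosen = "elements chosen_field"
  using ordered_field_chosen by (auto simp: ordered_field_def Let_def)

instantiation chosen :: linordered_field
begin

definition "(0 :: chosen) = Abs_chosen (zero chosen_field)"
definition "(1 :: chosen) = Abs_chosen (unit chosen_field)"
definition "x + y = Abs_chosen (plus chosen_field (Rep_chosen x) (Rep_chosen y))"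
definition "x * y = Abs_chosen (mult chosen_field (Rep_chosen x) (Rep_chosen y))"
definition "x \<le> y \<longleftrightarrow> leq chosen_field (Rep_chosen x) (Rep_chosen y)"
definition "x < y \<longleftrightarrow> x \<le> y \<and> x \<noteq> (y :: chosen)"
text \<open>The structure has no operations for negatives and inverses, only their existence; as
  they are unique, \<open>SOME\<close> denotes the right element. The inverse of 0 is 0 by the
  convention of HOL.\<close>

definition "- x = (SOME y. x + y = (0 :: chosen))"
definition "x - y = x + - (y :: chosen)"
definition "inverse x = (if x = 0 then 0 else SOME y. x * y = (1 :: chosen))"
definition "x div y = x * inverse (y :: chosen)"
definition "\<bar>x\<bar> = (if x < 0 then - x else (x :: chosen))"
definition "sgn x = (if x = 0 then 0 else if 0 < x then 1 else - 1 :: chosen)"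

lemma Rep_chosen_simps:
  "Rep_chosen 0 = zero chosen_field" "Rep_chosen 1 = unit chosen_field"
  "Rep_chosen (x + y) = plus chosen_field (Rep_chosen x) (Rep_chosen y)"
  "Rep_chosen (x * y) = mult chosen_field (Rep_chosen x) (Rep_chosen y)"
  using ordered_field_chosen Rep_chosen[of x] Rep_chosen[of y]
  unfolding zero_chosen_def one_chosen_def plus_chosen_def times_chosen_def ordered_field_def Let_def
  by (simp_all add: Abs_chosen_inverse)

lemma chosen_add:
  "a + b + c = a + (b + (c :: chosen))" "a + b = b + (a :: chosen)" "a + 0 = (a :: chosen)"
  "a + - a = (0 :: chosen)"
proof -
  note D = ordered_fieldD[OF ordered_field_chosen]
  show "a + b + c = a + (b + c)" "a + b = b + a" "a + 0 = a"
    unfolding Rep_chosen_inject[symmetric] Rep_chosen_simps by (simp_all only: D(4,10,15) Rep_chosen)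
  have "\<exists>b. a + b = 0"
    using D(6)[OF Rep_chosen[of a]] unfolding Rep_chosen_inject[symmetric] Rep_chosen_simps
    by (metis Rep_chosen_cases)
  then show "a + - a = 0"
    unfolding uminus_chosen_def by (rule someI_ex)
qed

lemma chosen_mult:
  "a * b * c = a * (b * (c :: chosen))" "a * b = b * (a :: chosen)" "a * 1 = (a :: chosen)"
  "a * (b + c) = a * b + a * (c :: chosen)" "0 \<noteq> (1 :: chosen)"
  "a \<noteq> 0 \<Longrightarrow> a * inverse a = (1 :: chosen)"
proof -
  note D = ordered_fieldD[OF ordered_field_chosen]
  show "a * b * c = a * (b * c)" "a * b = b * a" "a * 1 = a" "a * (b + c) = a * b + a * c" "0 \<noteq> (1 :: chosen)"
    unfolding Rep_chosen_inject[symmetric] Rep_chosen_simps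
    by (simp_all only: D(3,5,11,16,17) Rep_chosen not_False_eq_True)
  assume "a \<noteq> 0"
  then have "\<exists>b. a * b = 1"
    using D(7)[OF Rep_chosen[of a]] unfolding Rep_chosen_inject[symmetric] Rep_chosen_simps
    by (metis Rep_chosen_cases)
  then have "a * (SOME b. a * b = 1) = 1" by (rule someI_ex)
  with \<open>a \<noteq> 0\<close> show "a * inverse a = 1"
    unfolding inverse_chosen_def by simp
qed

lemma chosen_le:
  "a \<le> b \<or> b \<le> (a :: chosen)" "a \<le> b \<Longrightarrow> b \<le> a \<Longrightarrow> a = (b :: chosen)"
  "a \<le> b \<Longrightarrow> b \<le> c \<Longrightarrow> a \<le> (c :: chosen)" "a \<le> b \<Longrightarrow> a + c \<le> b + (c :: chosen)"
  "0 \<le> a \<Longrightarrow> 0 \<le> b \<Longrightarrow> 0 \<le> a * (b :: chosen)"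
  using ordered_fieldD(12-14,18,19)[OF ordered_field_chosen] Rep_chosen
  unfolding Rep_chosen_inject[symmetric] Rep_chosen_simps less_eq_chosen_def by metis+

instance
proof
  fix a b c :: chosen
  show add: "a + b + c = a + (b + c)" "a * b * c = a * (b * c)" "a + b = b + a" "a * b = b * a"
    by (fact chosen_add chosen_mult)+
  have add0: "0 + x = x" and neg: "- x + x = 0" for x :: chosen
    using chosen_add(2-4) by metis+
  have dist: "(x + y) * z = x * z + y * z" for x y z :: chosen
    using chosen_mult(2,4) by metis
  show "0 + a = a" "- a + a = 0" "(a + b) * c = a * c + b * c" by (fact add0 neg dist)+
  have zero: "x * 0 = (0 :: chosen)" for x
  proof -
    have "x * 0 + x * 0 = x * 0" using chosen_mult(4)[of x 0 0] add0 by metis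
    then show ?thesis using chosen_add by metis
  qed
  show "a * 0 = 0" by (fact zero)
  show "0 * a = 0" using zero chosen_mult(2) by metis
  have minus: "x - y = z \<longleftrightarrow> x = z + y" for x y z :: chosen
    unfolding minus_chosen_def using chosen_add by metis
  show "a + b - a = b" unfolding minus by (fact chosen_add)
  show "a - b - c = a - (b + c)" unfolding minus
    unfolding minus_chosen_def using chosen_add by metis
  show "1 * a = a" using chosen_mult(2,3) by metis
  show "0 \<noteq> (1 :: chosen)" by (fact chosen_mult)
  show "a - b = a + - b" "a div b = a * inverse b" "inverse (0 :: chosen) = 0"
    by (simp_all add: minus_chosen_def divide_chosen_def inverse_chosen_def)
  show "a \<noteq> 0 \<Longrightarrow> inverse a * a = 1" using chosen_mult(2,6) by metis
  show "(a < b) = (a \<le> b \<and> \<not> b \<le> a)"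
    unfolding less_chosen_def using chosen_le(1,2) by metis
  show "a \<le> a" using chosen_le(1)[of a a] by simp
  show "a \<le> b \<Longrightarrow> b \<le> c \<Longrightarrow> a \<le> c" "a \<le> b \<Longrightarrow> b \<le> a \<Longrightarrow> a = b" "a \<le> b \<or> b \<le> a"
    by (fact chosen_le)+
  show "a \<le> b \<Longrightarrow> c + a \<le> c + b" using chosen_le(4) chosen_add(2) by metis
  show "\<bar>a\<bar> = (if a < 0 then - a else a)" "sgn a = (if a = 0 then 0 else if 0 < a then 1 else - 1)"
    by (simp_all add: abs_chosen_def sgn_chosen_def)
  show "a < b \<Longrightarrow> 0 < c \<Longrightarrow> c * a < c * b"
  proof -
    assume "a < b" "0 < c"
    \<comment> \<open>Inverses exclude zero divisors; applied to c and b - a this makes the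
      inequality strict.\<close>
    have nz: "x * y \<noteq> 0" if "x \<noteq> 0" "y \<noteq> 0" for x y :: chosen
    proof
      assume "x * y = 0"
      then have "inverse x * (x * y) = 0" using zero by simp
      moreover have "inverse x * (x * y) = y"
        using chosen_mult(1-3,6) that(1) by metis
      ultimately show False using that(2) by simp
    qed
    let ?d = "b + - a"
    have "0 \<le> ?d"
      using \<open>a < b\<close> chosen_le(4)[of a b "- a"] chosen_add(4) unfolding less_chosen_def by metis
    moreover have "b = a + ?d" using chosen_add by metis
    then have "?d \<noteq> 0" using \<open>a < b\<close> chosen_add(3) unfolding less_chosen_def by metis
    ultimately have "0 \<le> c * ?d" "c * ?d \<noteq> 0"
      using \<open>0 < c\<close> chosen_le(5) nz unfolding less_chosen_def by auto
    moreover have b: "c * b = c * a + c * ?d" using \<open>b = a + ?d\<close> chosen_mult(4) by metis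
    ultimately have "c * a \<le> c * b"
      using chosen_le(4)[of 0 "c * ?d" "c * a"] chosen_add(2,3) by metis
    moreover have "c * a \<noteq> c * b"
    proof
      assume "c * a = c * b"
      with b have "c * a + c * ?d = c * a" by simp
      then have "c * ?d = 0" using chosen_add by metis
      with \<open>c * ?d \<noteq> 0\<close> show False ..
    qed
    ultimately show "c * a < c * b" unfolding less_chosen_def ..
  qed
qed

end


text \<open>If there were a counterexample, the chosen field would be one, and
  \<open>Rep_chosen\<close> would name the elements of the field in its model. This makes the model
  a \<open>real_model\<close>, where reversibility is proved.\<close>

lemma no_counterexample: "\<not> counterexample K"
proof
  assume "counterexample K"
  then have "Ex counterexample" ..
  then have "counterexample chosen_field"
    unfolding chosen_field_def by (simp add: someI_ex)
  then obtain E e v where "ZF_model E e" and K: "ZF_model.presents E v chosen_field"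
    and v: "\<not> set_model.holds E e 6 v reversible"
    unfolding counterexample_def by blast
  interpret ZF_model E e by fact
  note p = K[unfolded presents_def]
  note complete_v = p[THEN conjunct2, THEN conjunct2, THEN conjunct2, THEN conjunct2, THEN conjunct2, THEN conjunct2]
  have mem: "E x (v 0) \<longleftrightarrow> x \<in> range Rep_chosen" for x
    using p type_definition.Rep_range[OF type_definition_chosen] by auto
  then have rep: "E (Rep_chosen x) (v 0)" for x by simp
  interpret real_model E e "v 0" "v 3" "v 4" "v 5" Rep_chosen
  proof
    show "Rep_chosen x = Rep_chosen y \<longleftrightarrow> x = y" for x y by (rule Rep_chosen_inject)
    show "E c (v 0) \<longleftrightarrow> c \<in> range Rep_chosen" for c by (rule mem)
    show "E (pr (pr (Rep_chosen x) (Rep_chosen y)) c) (v 3) \<longleftrightarrow> c = Rep_chosen (x + y)"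
      "E (pr (pr (Rep_chosen x) (Rep_chosen y)) c) (v 4) \<longleftrightarrow> c = Rep_chosen (x * y)"
      "E (pr (Rep_chosen x) (Rep_chosen y)) (v 5) \<longleftrightarrow> x \<le> y" for x y c
      using p rep by (simp_all add: Rep_chosen_simps less_eq_chosen_def)
    show "\<exists>s. (\<forall>x. E (Rep_chosen x) A \<longrightarrow> x \<le> s) \<and> (\<forall>b. (\<forall>x. E (Rep_chosen x) A \<longrightarrow> x \<le> b) \<longrightarrow> s \<le> b)"
      if A: "\<And>x. E x A \<Longrightarrow> E x (v 0)" "E (Rep_chosen a) A" "\<And>x. E (Rep_chosen x) A \<Longrightarrow> x \<le> b" for A a b
    proof -
      have "leq chosen_field x (Rep_chosen b)" if "E x A" for x
        using A(1)[OF that] A(3) that mem by (auto simp: less_eq_chosen_def)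
      then have "\<exists>s. E s (v 0) \<and> (\<forall>x. E x A \<longrightarrow> leq chosen_field x s) \<and>
        (\<forall>b. E b (v 0) \<and> (\<forall>x. E x A \<longrightarrow> leq chosen_field x b) \<longrightarrow> leq chosen_field s b)"
        using A(1,2) rep
        by (intro complete_v[THEN spec[of _ A], THEN spec[of _ "Rep_chosen a"], THEN spec[of _ "Rep_chosen b"], THEN mp]) simp
      then obtain s where s: "E s (v 0)" "\<forall>x. E x A \<longrightarrow> leq chosen_field x s"
        "\<forall>b. E b (v 0) \<and> (\<forall>x. E x A \<longrightarrow> leq chosen_field x b) \<longrightarrow> leq chosen_field s b"
        by (elim exE conjE)
      from s(1) obtain s' where s': "s = Rep_chosen s'" using mem by auto
      have "s' \<le> b" if b: "\<And>x. E (Rep_chosen x) A \<Longrightarrow> x \<le> b" for b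
      proof -
        have "leq chosen_field x (Rep_chosen b)" if "E x A" for x
          using A(1)[OF that] b that mem by (auto simp: less_eq_chosen_def)
        with s(3)[THEN spec[of _ "Rep_chosen b"]] rep show ?thesis by (simp add: less_eq_chosen_def s')
      qed
      then show ?thesis using s(2) by (intro exI[of _ s']) (auto simp: less_eq_chosen_def s')
    qed
  qed
  have "base 6 v"
    using p by (simp add: Rep_chosen_simps)
  then show False
    using quasi_isometries_reversible v by blast
qed

theorem nat_model_reversible:
  fixes E :: "nat \<Rightarrow> nat \<Rightarrow> bool"
  assumes "ZF_model E e" and c: "set_model.holds E e 6 v (is_complete_ordered_field reals)"
  shows "set_model.holds E e 6 v reversible"
proof -
  interpret ZF_model E e by fact
  obtain K where "ordered_field K" "presents v K"
    using field_structure_exists[OF c] by blast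
  then show ?thesis
    using no_counterexample[of K] assms(1) unfolding counterexample_def by blast
qed

text \<open>Forming singletons is injective on D, so on a finite D it would be surjective; but the
  empty set, provided by the axiom of infinity, is no singleton.\<close>

lemma ZF_model_infinite:
  assumes M: "\<And>\<phi>. \<phi> \<in> ZF \<Longrightarrow> sat D E e \<phi>"
  shows "infinite D"
proof
  assume D: "finite D"
  have "close pairing \<in> ZF" by (simp add: ZF_def)
  note forms = close_def fAll_def fEx_def fNot_def fOr_def fIff_def fAnd_def fImp_def fMem_def
    fEq_def fBall_def fBex_def
  from M[OF \<open>close pairing \<in> ZF\<close>]
  have pairs: "\<forall>x\<in>D. \<forall>y\<in>D. \<exists>a\<in>D. \<forall>z\<in>D. (E z a \<longrightarrow> z = x \<or> z = y) \<and> (z \<noteq> x \<and> z \<noteq> y \<or> E z a)"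
    by (simp add: pairing_def forms)
  have "\<exists>a. a \<in> D \<and> (\<forall>z\<in>D. E z a \<longleftrightarrow> z = x)" if x: "x \<in> D" for x
  proof -
    obtain a where "a \<in> D" "\<forall>z\<in>D. (E z a \<longrightarrow> z = x \<or> z = x) \<and> (z \<noteq> x \<and> z \<noteq> x \<or> E z a)"
      using pairs[THEN bspec, OF x, THEN bspec, OF x] by (elim bexE)
    then show ?thesis by (intro exI[of _ a]) auto
  qed
  then obtain s where s: "\<And>x. x \<in> D \<Longrightarrow> s x \<in> D" "\<And>x z. x \<in> D \<Longrightarrow> z \<in> D \<Longrightarrow> E z (s x) \<longleftrightarrow> z = x"
    by metis
  have "inj_on s D"
  proof
    fix x y assume "x \<in> D" "y \<in> D" "s x = s y"
    then show "x = y" using s(2)[of x x] s(2)[of y x] by simp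
  qed
  moreover have "s ` D \<subseteq> D" using s(1) by auto
  ultimately have range: "s ` D = D" using D by (simp add: endo_inj_surj)
  have "close infinity \<in> ZF" by (simp add: ZF_def)
  from M[OF this] have "\<not> (\<forall>x\<in>D. \<exists>z\<in>D. E z x)"
    by (simp add: infinity_def forms) blast
  then obtain x where "x \<in> D" and x: "\<forall>z\<in>D. \<not> E z x" by auto
  then obtain y where "y \<in> D" "x = s y" using range by auto
  then show False using x s(2)[of y y] by simp
qed

text \<open>The term model is countable, and infinite by ZF, so it can be transported to
  \<open>nat\<close>. Having one fixed type for all models is what allows the field of a
  counterexample to be selected globally.\<close>

theorem derivable_if_true_in_nat_models:
  assumes "\<And>(E :: nat \<Rightarrow> nat \<Rightarrow> bool) e. ZF_model E e \<Longrightarrow> sat UNIV E e \<phi>"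
  shows "ZF \<turnstile> \<phi>"
proof (rule ccontr)
  assume "\<not> ZF \<turnstile> \<phi>"
  then have "consistent (insert (Imp \<phi> Fls) ZF)" using raa by blast
  then obtain D :: "nat set set" and E e where D: "countable D" "range e \<subseteq> D"
    and M: "\<And>\<psi>. \<psi> \<in> insert (Imp \<phi> Fls) ZF \<Longrightarrow> sat D E e \<psi>"
    by (rule model_existence) blast
  have "infinite D" using M by (intro ZF_model_infinite) blast
  then have h: "bij_betw (to_nat_on D) D UNIV"
    using D(1) by (rule to_nat_on_infinite[rotated])
  let ?E = "\<lambda>x y. E (the_inv_into D (to_nat_on D) x) (the_inv_into D (to_nat_on D) y)"
  let ?e = "\<lambda>i. to_nat_on D (e i)"
  have sat: "sat UNIV ?E ?e \<psi> \<longleftrightarrow> sat D E e \<psi>" for \<psi>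
    by (rule sat_bij[OF h D(2)])
  then have "ZF_model ?E ?e" using M by (intro ZF_model.intro) auto
  then have "sat UNIV ?E ?e \<phi>" by (rule assms)
  with sat M[of "Imp \<phi> Fls"] show False by simp
qed

theorem theorem3:
  "ZF \<turnstile> close
     (\<^bold>\<forall>R z e add mul le.
        let F = \<lparr>carr = R, zer = z, uni = e, addition = add, multiplication = mul, order = le\<rparr> in
        is_complete_ordered_field F \<^bold>\<longrightarrow>
        (\<^bold>\<forall>S dS T dT.
           is_real_tree F S dS \<^bold>\<and> is_real_tree F T dT \<^bold>\<longrightarrow>
           (\<^bold>\<exists>f. is_quasi_isometry F S dS T dT f) \<^bold>\<longrightarrow>
           (\<^bold>\<exists>g. is_quasi_isometry F T dT S dS g)))"
  (is "ZF \<turnstile> close ?\<Phi>")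
proof (rule derivable_if_true_in_nat_models)
  fix E :: "nat \<Rightarrow> nat \<Rightarrow> bool" and e
  assume M: "ZF_model E e"
  interpret ZF_model E e by fact
  \<comment> \<open>The six outer quantifiers bind the levels 0 to 5 in this order, so the record of
    the statement becomes \<open>reals\<close>.\<close>
  have levels: "\<lparr>carr = 0, zer = Suc 0, uni = Suc (Suc 0), addition = Suc (Suc (Suc 0)),
      multiplication = Suc (Suc (Suc (Suc 0))), order = Suc (Suc (Suc (Suc (Suc 0))))\<rparr> = reals"
    by (simp add: eval_nat_numeral)
  have six: "Suc (Suc (Suc (Suc (Suc (Suc 0))))) = 6"
    by simp
  have "holds (Suc (Suc (Suc (Suc (Suc (Suc 0)))))) v (is_complete_ordered_field reals \<^bold>\<longrightarrow> reversible)" for v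
    unfolding six holds_connectives(3) using nat_model_reversible[OF M, of v] by (rule HOL.impI)
  then have "holds 0 e ?\<Phi>"
    by (simp only: holds_connectives(8) Let_def levels simp_thms)
  moreover have "env 0 e e = e" by (rule ext) (simp add: env_def)
  ultimately show "sat UNIV E e (close ?\<Phi>)"
    by (simp add: holds_def close_def)
qed

end
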